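(* Let $\alpha$ be the parameter of a family of very simple increasing trees, let $D(\mathcal{T}_n)$ be the depth of the centroid (the one nearest to the root) in a random tree of size $n$, and let $\mathcal{D}$ be its limiting random variable (defined in the context). For every integer $m\ge1$, the limit as $n\to\infty$ of the $m$th factorial moment $E_n(D^{\underline{m}})$ is $$E(\mathcal{D}^{\underline{m}})=m\alpha^m\left(2\sum_{j=0}^{m-2}\binom{m-1}{j}(-1)^jj!\,(\ln2)^{m-1-j}+(-1)^{m-1}(m-1)!\right).$$ In particular, the limits of the mean and the variance of $D(\mathcal{T}_n)$ are $E(\mathcal{D})=\alpha$ and $V(\mathcal{D})=\alpha^2(4\ln2-3)+\alpha$.
   Context: Notation: $x^{\underline{m}}=x(x-1)\cdots(x-m+1)$ is the falling factorial; $V$ denotes variance. Random trees. An increasing tree of size $n$ is a rooted tree with $n$ nodes labelled $1,\dots,n$ such that labels increase along every path leading away from the root (so the root has label $1$). A family of very simple increasing trees is given by real constants $c_1>0$ and $c_2$; put $\alpha=1+c_2/c_1>0$. The admissible cases are: $c_2=0$, $\alpha=1$ (general recursive trees); $c_2<0$, $0<\alpha<1$ (general plane-oriented trees); $c_2>0$, $\alpha=d/(d-1)$ with an integer $d\ge2$ (general $d$-ary increasing trees). A plane (i.e. ordered) increasing tree $T$ has weight $\omega(T)=\prod_v\phi_{\mathrm{outdeg}(v)}$, where $\sum_i\phi_iu^i=\phi(u)$ with $\phi(u)=\exp(c_1u)$ if $c_2=0$ and $\phi(u)=(1+c_2u)^{1+c_1/c_2}$ otherwise; a random tree $\mathcal{T}_n$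 of size $n$ is drawn with probability proportional to its weight. Equivalently (ignoring the order of children), the random tree is produced by the growth process which starts with the root $1$ and, for $i=2,\dots,n$, attaches node $i$ as a child to an existing node of current out-degree $k$ with probability $\frac{\alpha-(\alpha-1)k}{i+\alpha-2}$. $E_n$ denotes expectation for a random tree of size $n$. Centroid. A centroid of a tree is a node minimising the sum of distances to all other nodes; equivalently, each branch at the node (maximal subtree not containing it) contains at most half of the nodes of the tree. Every tree has one centroid or two adjacent centroids; "the centroid" means the one nearest to the root. $D=D(T)$ is the number of edges on the path from the root to the centroid. Limit variable. $\mathcal{D}$ takes values in $\mathbb{Z}_{\ge0}$, with $$P(\mathcal{D}=h)=\frac{\alpha^h}{(\alpha-1)^{h+1}}\left[2^{1-\alpha}\left(\sum_{j=0}^{h-1}\frac{((\alpha-1)\ln 2)^j}{j!}+\frac{\alpha((\alpha-1)\ln 2)^h}{h!}\right)-1\right]$$ for $\alpha\ne1$, and $P(\mathcal{D}=h)=\frac{(\ln2)^h}{h!}-\frac{(\ln2)^{h+1}}{(h+1)!}$ for $\alpha=1$. *)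

theory Defs
  imports "HOL-Probability.Probability" "HOL-Computational_Algebra.Formal_Power_Series"
begin

datatype plane_tree = Vertex (root: nat) (subtrees: "plane_tree list")

fun labels :: "plane_tree \<Rightarrow> nat list" where
  "labels (Vertex v ts) = v # concat (map labels ts)"

text \<open>Nodes are identified with their labels, which are distinct in the trees considered below.\<close>

definition nodes :: "plane_tree \<Rightarrow> nat set" where
  "nodes T = set (labels T)"

fun edges :: "plane_tree \<Rightarrow> (nat \<times> nat) set" where
  "edges (Vertex v ts) = (\<lambda>t. (v, root t)) ` set ts \<union> (\<Union>t\<in>set ts. edges t)"

fun increasing :: "plane_tree \<Rightarrow> bool" where
  "increasing (Vertex v ts) \<longleftrightarrow> (\<forall>t\<in>set ts. v < root t \<and> increasing t)"

definition increasing_trees :: "nat \<Rightarrow> plane_tree set" where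
  "increasing_trees n = {T. distinct (labels T) \<and> nodes T = {1..n} \<and> increasing T}"

text \<open>The power series of \<open>exp (c1 u)\<close> if \<open>c2 = 0\<close>, and of \<open>(1 + c2 u) powr (1 + c1 / c2)\<close>
  otherwise; here \<open>fps_binomial a\<close> is the series of \<open>(1 + u) powr a\<close>.\<close>

definition degree_fps :: "real \<Rightarrow> real \<Rightarrow> real fps" where
  "degree_fps c1 c2 =
     (if c2 = 0 then fps_exp c1
      else fps_binomial (1 + c1 / c2) oo (fps_const c2 * fps_X))"

fun weight :: "real fps \<Rightarrow> plane_tree \<Rightarrow> real" where
  "weight \<phi> (Vertex v ts) = fps_nth \<phi> (length ts) * prod_list (map (weight \<phi>) ts)"

text \<open>For \<open>n = 0\<close> there are no trees and the value is unspecified.\<close>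

definition random_tree :: "real \<Rightarrow> real \<Rightarrow> nat \<Rightarrow> plane_tree pmf" where
  "random_tree c1 c2 n = embed_pmf (\<lambda>T.
     if T \<in> increasing_trees n
     then weight (degree_fps c1 c2) T / (\<Sum>S\<in>increasing_trees n. weight (degree_fps c1 c2) S)
     else 0)"

definition tree_dist :: "plane_tree \<Rightarrow> nat \<Rightarrow> nat \<Rightarrow> nat" where
  "tree_dist T u v = (LEAST k. (u, v) \<in> (edges T \<union> (edges T)\<inverse>) ^^ k)"

definition is_centroid :: "plane_tree \<Rightarrow> nat \<Rightarrow> bool" where
  "is_centroid T =
     is_arg_min (\<lambda>v. \<Sum>w\<in>nodes T - {v}. tree_dist T v w) (\<lambda>v. v \<in> nodes T)"

text \<open>If there are two centroids, they are adjacent, so exactly one is nearest to the root.\<close>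

definition centroid :: "plane_tree \<Rightarrow> nat" where
  "centroid T = arg_min (tree_dist T (root T)) (is_centroid T)"

definition centroid_depth :: "plane_tree \<Rightarrow> nat" where
  "centroid_depth T = tree_dist T (root T) (centroid T)"

definition limit_prob :: "real \<Rightarrow> nat \<Rightarrow> real" where
  "limit_prob \<alpha> h =
     (if \<alpha> = 1 then ln 2 ^ h / fact h - ln 2 ^ (h + 1) / fact (h + 1)
      else \<alpha> ^ h / (\<alpha> - 1) ^ (h + 1) *
        (2 powr (1 - \<alpha>) *
           ((\<Sum>j<h. ((\<alpha> - 1) * ln 2) ^ j / fact j) + \<alpha> * ((\<alpha> - 1) * ln 2) ^ h / fact h) - 1))"

definition limit_depth :: "real \<Rightarrow> nat pmf" where
  "limit_depth \<alpha> = embed_pmf (limit_prob \<alpha>)"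

definition falling_fact :: "real \<Rightarrow> nat \<Rightarrow> real" where
  "falling_fact x m = (\<Prod>i<m. x - real i)"

end

theory Submission
  imports Defs "HOL-Real_Asymp.Real_Asymp"
begin

text \<open>Call a node heavy if its fringe subtree (the node with all its descendants) has more than
  \<open>n / 2\<close> of the \<open>n\<close> nodes. Moving from a node to its child \<open>v\<close> changes the sum of distances
  by \<open>n - 2 k\<close>, where \<open>k\<close> is the size of the fringe subtree of \<open>v\<close>. At most one
  child of a node is heavy, so the heavy nodes form a path from the root, and it ends at the
  centroid. Therefore the depth \<open>D\<close> of the centroid is the number of heavy nodes other than the
  root (\<open>heavy_gf_centroid_depth\<close>).

  This turns a statement about distances into one about fringe subtree sizes, which evolve simply
  when a tree grows: a subtree of size \<open>k\<close> in a tree of size \<open>n\<close> receives the next leaf with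
  probability \<open>(k + \<alpha> - 1) / (n + \<alpha> - 1)\<close>. For the expected sum \<open>H\<^sub>n\<^sub>,\<^sub>s(z)\<close> of
  \<open>z ^ (depth - 1)\<close> over the nodes, other than the root, with a fringe subtree of size above \<open>s\<close>,
  this gives
  \<open>(n + \<alpha> - 1) H\<^sub>n\<^sub>+\<^sub>1\<^sub>,\<^sub>s = (n - s) H\<^sub>n\<^sub>,\<^sub>s + (s + \<alpha> - 1) H\<^sub>n\<^sub>,\<^sub>s\<^sub>-\<^sub>1\<close>
  (\<open>sum_heavy_gf_grow\<close>), with a similar recurrence for \<open>s = 0\<close>. With \<open>z = 1 + t\<close> the
  solution is explicit (\<open>heavy_weight_eq\<close>):
  \<open>(1 + \<alpha> t) H\<^sub>n\<^sub>,\<^sub>s = \<alpha> ((n + \<alpha> - 1) / (s + \<alpha>) \<Prod>\<^sub>s\<^sub><\<^sub>j\<^sub><\<^sub>n (1 + \<alpha> t / (j + \<alpha>)) - 1)\<close>.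

  For \<open>s = \<lfloor>n / 2\<rfloor>\<close> the left-hand side contains the expectation of
  \<open>\<Sum>\<^sub>j\<^sub><\<^sub>D z ^ j = ((1 + t) ^ D - 1) / t\<close>, whose coefficients in \<open>t\<close> are the binomial moments of
  \<open>D\<close>. On the right, the quotient tends to \<open>2\<close> and, since
  \<open>\<Sum>\<^sub>s\<^sub><\<^sub>j\<^sub><\<^sub>n 1 / (j + \<alpha>)\<close> tends to \<open>ln 2\<close>, the coefficients of the product tend to those of
  \<open>exp (\<alpha> t ln 2)\<close> (\<open>coeff_prod_linear_tendsto\<close>). Comparing coefficients yields a recursion
  for the limits of the factorial moments (\<open>factorial_moment_tendsto\<close>).

  The moments of the limit law satisfy the same recursion: up to the constant term, its
  probabilities obey a two-term linear recurrence with Poisson probabilities on the right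
  (\<open>limit_prob_Suc\<close>), and summing it against falling factorials gives the moments
  (\<open>limit_prob_sums\<close>). Mean and variance are the cases \<open>m = 1\<close> and \<open>m = 2\<close>.\<close>

section \<open>Distances in a tree\<close>

abbreviation links :: "plane_tree \<Rightarrow> (nat \<times> nat) set" where
  "links T \<equiv> edges T \<union> (edges T)\<inverse>"

lemma nodes_Vertex: "nodes (Vertex v ts) = insert v (\<Union>t\<in>set ts. nodes t)"
  by (simp add: nodes_def)

lemma root_in_nodes [simp]: "root T \<in> nodes T"
  by (cases T) (simp add: nodes_def)

lemma finite_nodes [simp]: "finite (nodes T)"
  by (simp add: nodes_def)

lemma edges_subset_nodes: "edges T \<subseteq> nodes T \<times> nodes T"
  by (induction T) (fastforce simp: nodes_Vertex)

lemma links_subset_nodes: "links T \<subseteq> nodes T \<times> nodes T"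
  using edges_subset_nodes[of T] by auto

lemma walk_sym: "(u, w) \<in> links T ^^ k \<Longrightarrow> (w, u) \<in> links T ^^ k"
proof (induction k arbitrary: w)
  case (Suc k)
  then obtain y where "(u, y) \<in> links T ^^ k" "(y, w) \<in> links T"
    by (meson relpow_Suc_E)
  with Suc.IH[of y] have "(w, y) \<in> links T" "(y, u) \<in> links T ^^ k"
    by blast+
  then show ?case by (rule relpow_Suc_I2)
qed auto

lemma links_child_mono: "t \<in> set ts \<Longrightarrow> links t \<subseteq> links (Vertex v ts)"
  by auto

lemma walk_child_mono:
  assumes "t \<in> set ts" "(u, w) \<in> links t ^^ k"
  shows "(u, w) \<in> links (Vertex v ts) ^^ k"
  using assms(2)
proof (induction k arbitrary: w)
  case (Suc k)
  then obtain y where y: "(u, y) \<in> links t ^^ k" "(y, w) \<in> links t"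
    by (meson relpow_Suc_E)
  then have "(y, w) \<in> links (Vertex v ts)"
    using links_child_mono[OF assms(1)] by blast
  with Suc.IH[OF y(1)] show ?case by (rule relpow_Suc_I)
qed simp

lemma root_walk: "u \<in> nodes T \<Longrightarrow> \<exists>k. (root T, u) \<in> links T ^^ k"
proof (induction T)
  case (Vertex v ts)
  show ?case
  proof (cases "u = v")
    case True
    then show ?thesis by (intro exI[of _ 0]) simp
  next
    case False
    with Vertex.prems obtain t where t: "t \<in> set ts" "u \<in> nodes t"
      by (auto simp: nodes_Vertex)
    with Vertex.IH obtain k where "(root t, u) \<in> links t ^^ k" by blast
    then have "(root t, u) \<in> links (Vertex v ts) ^^ k"
      using t(1) by (rule walk_child_mono[rotated])
    moreover have "(v, root t) \<in> links (Vertex v ts)" using t(1) by auto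
    ultimately have "(v, u) \<in> links (Vertex v ts) ^^ Suc k"
      by (meson relpow_Suc_I2)
    then show ?thesis unfolding plane_tree.sel by (rule exI)
  qed
qed

lemma tree_dist_le: "(u, w) \<in> links T ^^ k \<Longrightarrow> tree_dist T u w \<le> k"
  unfolding tree_dist_def by (rule Least_le)

lemma tree_dist_walk:
  assumes "u \<in> nodes T" "w \<in> nodes T"
  shows "(u, w) \<in> links T ^^ tree_dist T u w"
proof -
  obtain i j where i: "(root T, u) \<in> links T ^^ i" and j: "(root T, w) \<in> links T ^^ j"
    using assms root_walk by blast
  from relpow_trans[OF walk_sym[OF i] j] have "(u, w) \<in> links T ^^ (i + j)" .
  then show ?thesis
    unfolding tree_dist_def by (rule LeastI)
qed

lemma tree_dist_refl [simp]: "tree_dist T u u = 0"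
  using tree_dist_le[of u u 0 T] by simp

lemma tree_dist_sym: "tree_dist T u w = tree_dist T w u"
proof -
  have "(u, w) \<in> links T ^^ k \<longleftrightarrow> (w, u) \<in> links T ^^ k" for k
    by (blast intro: walk_sym)
  then show ?thesis by (simp only: tree_dist_def)
qed

lemma tree_dist_step:
  assumes "u \<in> nodes T" "(w, w') \<in> links T"
  shows "tree_dist T u w' \<le> tree_dist T u w + 1"
proof -
  have "w \<in> nodes T" using assms(2) links_subset_nodes by blast
  from tree_dist_le[OF relpow_Suc_I[OF tree_dist_walk[OF assms(1) this] assms(2)]]
  show ?thesis by (simp only: Suc_eq_plus1)
qed

text \<open>Lower bounds on distances come from functions that change by at most one along each edge.\<close>

lemma lipschitz_le_walk:
  fixes f :: "nat \<Rightarrow> nat"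
  assumes "\<And>w w'. (w, w') \<in> R \<Longrightarrow> f w' \<le> f w + 1" and "f u = 0" and "(u, w) \<in> R ^^ k"
  shows "f w \<le> k"
  using assms(3)
proof (induction k arbitrary: w)
  case (Suc k)
  from Suc.prems obtain y where y: "(u, y) \<in> R ^^ k" "(y, w) \<in> R" by (meson relpow_Suc_E)
  show ?case using Suc.IH[OF y(1)] assms(1)[OF y(2)] by linarith
qed (simp add: assms(2))

lemma disjoint_concat_map:
  assumes "distinct (concat (map f ts))" "t \<in> set ts" "t' \<in> set ts" "t' \<noteq> t"
  shows "set (f t') \<inter> set (f t) = {}"
  using assms by (induction ts) fastforce+

lemma distinct_Vertex:
  assumes "distinct (labels (Vertex v ts))" "t \<in> set ts"
  shows "v \<notin> nodes t" "distinct (labels t)"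
    and "t' \<in> set ts \<Longrightarrow> t' \<noteq> t \<Longrightarrow> nodes t' \<inter> nodes t = {}"
proof -
  have *: "v \<notin> (\<Union>t\<in>set ts. set (labels t))" "distinct (concat (map labels ts))"
    using assms(1) by simp_all
  show "v \<notin> nodes t" using *(1) assms(2) unfolding nodes_def by blast
  show "distinct (labels t)" using *(2) assms(2) by (simp add: distinct_concat_iff)
  show "nodes t' \<inter> nodes t = {}" if "t' \<in> set ts" "t' \<noteq> t"
    unfolding nodes_def using disjoint_concat_map[OF *(2) assms(2)] that by simp
qed

text \<open>A branch \<open>t\<close> is joined to the rest of the tree by the single edge from \<open>v\<close> to its root:
  distances inside \<open>t\<close> are those of \<open>t\<close>, and every walk that leaves \<open>t\<close> passes through \<open>v\<close>.\<close>

lemma tree_dist_child: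
  assumes dist: "distinct (labels (Vertex v ts))" and t: "t \<in> set ts"
    and u: "u \<in> nodes t" and w: "w \<in> nodes (Vertex v ts)"
  shows "tree_dist (Vertex v ts) u w =
    (if w \<in> nodes t then tree_dist t u w
     else tree_dist t (root t) u + 1 + tree_dist (Vertex v ts) v w)"
proof -
  let ?T = "Vertex v ts"
  define f where "f w = (if w \<in> nodes t then tree_dist t u w
     else tree_dist t u (root t) + 1 + tree_dist ?T v w)" for w
  have v_in: "v \<in> nodes ?T" by (simp add: nodes_Vertex)
  have uT: "u \<in> nodes ?T" using t u by (auto simp: nodes_Vertex)
  have "f w \<le> tree_dist ?T u w"
  proof (rule lipschitz_le_walk[where R = "links ?T" and u = u and f = f])
    fix a b assume ab: "(a, b) \<in> links ?T"
    have cases: "(a, b) \<in> links t \<or> (a \<notin> nodes t \<and> b \<notin> nodes t)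
        \<or> (a = v \<and> b = root t) \<or> (a = root t \<and> b = v)"
    proof -
      have "(x, y) \<in> links t \<or> (x \<notin> nodes t \<and> y \<notin> nodes t) \<or> (x = v \<and> y = root t)"
        if "(x, y) \<in> edges ?T" for x y
      proof -
        from that have "(\<exists>t'\<in>set ts. x = v \<and> y = root t') \<or> (\<exists>t'\<in>set ts. (x, y) \<in> edges t')"
          by auto
        then show ?thesis
        proof (elim disjE bexE conjE)
          fix t' assume t': "t' \<in> set ts" "x = v" "y = root t'"
          show ?thesis
          proof (cases "t' = t")
            case False
            then have "y \<notin> nodes t"
              using distinct_Vertex(3)[OF dist t t'(1)] root_in_nodes[of t'] t'(3) by blast
            then show ?thesis using distinct_Vertex(1)[OF dist t] t'(2) by simp
          qed (simp add: t')
        next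
          fix t' assume t': "t' \<in> set ts" "(x, y) \<in> edges t'"
          show ?thesis
          proof (cases "t' = t")
            case False
            have "x \<in> nodes t'" "y \<in> nodes t'" using t'(2) edges_subset_nodes by blast+
            then have "x \<notin> nodes t" "y \<notin> nodes t"
              using distinct_Vertex(3)[OF dist t t'(1) False] by blast+
            then show ?thesis by simp
          qed (use t' in simp)
        qed
      qed
      note step = this
      from ab have "(a, b) \<in> edges ?T \<or> (b, a) \<in> edges ?T" by blast
      then show ?thesis
      proof
        assume "(a, b) \<in> edges ?T"
        from step[OF this] show ?thesis by blast
      next
        assume "(b, a) \<in> edges ?T"
        from step[OF this] show ?thesis by blast
      qed
    qed
    have v_notin: "v \<notin> nodes t" using distinct_Vertex(1)[OF dist t] .
    from cases show "f b \<le> f a + 1"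
    proof (elim disjE conjE)
      assume "(a, b) \<in> links t"
      moreover from this have "a \<in> nodes t" "b \<in> nodes t"
        using links_subset_nodes by blast+
      ultimately show ?thesis
        using tree_dist_step[OF u, of a b] by (simp add: f_def)
    next
      assume "a \<notin> nodes t" "b \<notin> nodes t"
      then show ?thesis using tree_dist_step[OF v_in ab] by (simp add: f_def)
    qed (use v_notin in \<open>simp_all add: f_def\<close>)
  next
    show "f u = 0" by (simp add: f_def u)
    show "(u, w) \<in> links ?T ^^ tree_dist ?T u w"
      by (rule tree_dist_walk[OF uT w])
  qed
  moreover have "tree_dist ?T u w \<le> f w"
  proof (rule tree_dist_le)
    have inside: "(a, b) \<in> links ?T ^^ tree_dist t a b" if "a \<in> nodes t" "b \<in> nodes t" for a b
      using tree_dist_walk[OF that] t by (rule walk_child_mono[rotated])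
    have "(root t, v) \<in> links ?T" using t by auto
    from relpow_Suc_I[OF inside[OF u root_in_nodes] this]
    have "(u, v) \<in> links ?T ^^ (tree_dist t u (root t) + 1)" by (simp only: Suc_eq_plus1)
    from relpow_trans[OF this tree_dist_walk[OF v_in w]]
    show "(u, w) \<in> links ?T ^^ f w"
      using inside[OF u, of w] by (simp add: f_def)
  qed
  ultimately have "tree_dist ?T u w = f w" by (rule antisym[rotated])
  then show ?thesis by (simp only: f_def tree_dist_sym[of t u "root t"])
qed

lemma tree_dist_root_child:
  assumes "distinct (labels (Vertex v ts))" "t \<in> set ts" "u \<in> nodes t"
  shows "tree_dist (Vertex v ts) v u = tree_dist t (root t) u + 1"
  using tree_dist_child[OF assms, of v] distinct_Vertex(1)[OF assms(1,2)]
  by (simp add: nodes_Vertex tree_dist_sym[of "Vertex v ts" v u])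

section \<open>The centroid\<close>

definition total_dist :: "plane_tree \<Rightarrow> nat \<Rightarrow> nat" where
  "total_dist T v = (\<Sum>w\<in>nodes T. tree_dist T v w)"

lemma is_centroid_iff:
  "is_centroid T v \<longleftrightarrow> v \<in> nodes T \<and> (\<forall>u\<in>nodes T. total_dist T v \<le> total_dist T u)"
proof -
  have "(\<Sum>w\<in>nodes T - {v}. tree_dist T v w) = total_dist T v" for v
    unfolding total_dist_def by (rule sum.mono_neutral_left) auto
  then show ?thesis
    unfolding is_centroid_def is_arg_min_def by (auto simp: not_less)
qed

lemma card_nodes: "distinct (labels T) \<Longrightarrow> card (nodes T) = length (labels T)"
  by (simp add: nodes_def distinct_card)

lemma length_labels_pos: "0 < length (labels T)"
  by (cases T) simp

text \<open>The cost of \<open>u\<close> when \<open>M\<close> further nodes hang above the root of \<open>T\<close>, up to a constant.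
  The extra load \<open>M\<close> is what makes the comparison of costs recursive.\<close>

definition loaded_dist :: "nat \<Rightarrow> plane_tree \<Rightarrow> nat \<Rightarrow> nat" where
  "loaded_dist M T u = total_dist T u + M * tree_dist T (root T) u"

text \<open>Moving from \<open>v\<close> into the branch \<open>t\<close> brings its nodes one step closer and takes all
  others one step away.\<close>

lemma loaded_dist_child:
  assumes dist: "distinct (labels (Vertex v ts))" and t: "t \<in> set ts"
    and u: "u \<in> nodes t"
    and M': "M' = M + length (labels (Vertex v ts)) - length (labels t)"
  shows "loaded_dist M (Vertex v ts) u + loaded_dist M' t (root t) + length (labels t)
       = loaded_dist M (Vertex v ts) v + loaded_dist M' t u + M'"
proof -
  let ?T = "Vertex v ts"
  define A where "A = nodes ?T - nodes t"
  have sub: "nodes t \<subseteq> nodes ?T" using t by (auto simp: nodes_Vertex)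
  have cA: "card A + length (labels t) = length (labels ?T)"
    unfolding A_def using sub card_nodes[OF dist] card_nodes[OF distinct_Vertex(2)[OF dist t]]
      card_Diff_subset[OF finite_nodes sub] card_mono[OF finite_nodes sub] by simp
  have split: "total_dist ?T a = (\<Sum>w\<in>nodes t. tree_dist ?T a w) + (\<Sum>w\<in>A. tree_dist ?T a w)" for a
    unfolding total_dist_def A_def using sum.subset_diff[OF sub, of "tree_dist ?T a"] by simp
  have v_notin: "v \<notin> nodes t" using distinct_Vertex[OF dist t] by simp
  have 1: "total_dist ?T u = total_dist t u
      + (card A * (tree_dist t (root t) u + 1) + (\<Sum>w\<in>A. tree_dist ?T v w))"
  proof -
    have "(\<Sum>w\<in>nodes t. tree_dist ?T u w) = total_dist t u"
      unfolding total_dist_def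
      by (rule sum.cong) (use tree_dist_child[OF dist t u] sub in auto)
    moreover have "(\<Sum>w\<in>A. tree_dist ?T u w)
        = (\<Sum>w\<in>A. (tree_dist t (root t) u + 1) + tree_dist ?T v w)"
      by (rule sum.cong) (use tree_dist_child[OF dist t u] in \<open>auto simp: A_def\<close>)
    ultimately show ?thesis
      unfolding split[of u] sum.distrib by simp
  qed
  have 2: "total_dist ?T v = total_dist t (root t) + length (labels t) + (\<Sum>w\<in>A. tree_dist ?T v w)"
  proof -
    have "(\<Sum>w\<in>nodes t. tree_dist ?T v w) = (\<Sum>w\<in>nodes t. tree_dist t (root t) w + 1)"
      by (rule sum.cong) (use tree_dist_root_child[OF dist t] in auto)
    also have "\<dots> = total_dist t (root t) + length (labels t)"
      unfolding sum.distrib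
      using card_nodes[OF distinct_Vertex(2)[OF dist t]] by (simp add: total_dist_def)
    finally show ?thesis unfolding split[of v] by simp
  qed
  have 3: "M' = M + card A" using M' cA by linarith
  show ?thesis
    unfolding loaded_dist_def 1 2 3
    using tree_dist_root_child[OF dist t u]
    by (simp add: algebra_simps)
qed

lemma length_labels_child:
  "t \<in> set ts \<Longrightarrow> length (labels t) < length (labels (Vertex v ts))"
  using member_le_sum_list[of "length (labels t)" "map (length \<circ> labels) ts"]
  by (simp add: length_concat o_def)

text \<open>If the root carries at least as much weight from above as there are nodes in the tree, then no
  step downwards pays.\<close>

lemma loaded_dist_root_min:
  assumes "distinct (labels T)" "length (labels T) \<le> M" "u \<in> nodes T"
  shows "loaded_dist M T (root T) \<le> loaded_dist M T u"
  using assms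
proof (induction T arbitrary: M)
  case (Vertex v ts)
  show ?case
  proof (cases "u = v")
    case False
    with Vertex.prems obtain t where t: "t \<in> set ts" "u \<in> nodes t" by (auto simp: nodes_Vertex)
    define M' where "M' = M + length (labels (Vertex v ts)) - length (labels t)"
    have M': "length (labels t) \<le> M'"
      using length_labels_child[OF t(1), of v] Vertex.prems(2) unfolding M'_def by linarith
    have "loaded_dist M' t (root t) \<le> loaded_dist M' t u"
      using Vertex.IH[OF t(1) _ M' t(2)] distinct_Vertex(2)[OF Vertex.prems(1) t(1)] by simp
    then show ?thesis
      using loaded_dist_child[OF Vertex.prems(1) t M'_def] M' by simp
  qed simp
qed

text \<open>The sum of \<open>z ^ (depth v - 1)\<close> over all nodes \<open>v\<close> other than the root whose fringe
  subtree has more than \<open>s\<close> nodes. Keeping track of depths is what encodes all moments of the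
  centroid depth, instead of the mean only, in one additive statistic.\<close>

fun heavy_gf :: "nat \<Rightarrow> real \<Rightarrow> plane_tree \<Rightarrow> real" where
  "heavy_gf s z (Vertex v ts) =
     (\<Sum>t\<leftarrow>ts. of_bool (s < length (labels t)) + z * heavy_gf s z t)"

lemma heavy_gf_light: "length (labels T) \<le> s \<Longrightarrow> heavy_gf s z T = 0"
proof (induction T)
  case (Vertex v ts)
  have "of_bool (s < length (labels t)) + z * heavy_gf s z t = 0" if "t \<in> set ts" for t
    using Vertex.IH[OF that] Vertex.prems length_labels_child[OF that, of v] by simp
  then have "(\<Sum>t\<leftarrow>ts. of_bool (s < length (labels t)) + z * heavy_gf s z t) = (\<Sum>t\<leftarrow>ts. 0)"
    by (intro arg_cong[of _ _ sum_list] map_cong) auto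
  then show ?case by (simp only: heavy_gf.simps sum_list_0)
qed

lemma loaded_dist_light_branch:
  assumes "distinct (labels (Vertex v ts))" "t \<in> set ts" "u \<in> nodes t"
    and "2 * length (labels t) \<le> M + length (labels (Vertex v ts))"
  shows "loaded_dist M (Vertex v ts) v \<le> loaded_dist M (Vertex v ts) u"
proof -
  define M' where "M' = M + length (labels (Vertex v ts)) - length (labels t)"
  have M': "length (labels t) \<le> M'" using assms(4) by (simp add: M'_def)
  have "loaded_dist M' t (root t) \<le> loaded_dist M' t u"
    using loaded_dist_root_min[OF distinct_Vertex(2)[OF assms(1,2)] M' assms(3)] .
  then show ?thesis
    using loaded_dist_child[OF assms(1-3) M'_def] M' by linarith
qed

text \<open>Along a path away from the root the cost drops exactly as long as the fringe subtrees
  contain more than half of all \<open>n\<close> nodes. Since at most one branch of a node is that large,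
  the cost is minimal at the end of the unique path of heavy nodes; every other minimiser is
  reached from there through a subtree with exactly \<open>n / 2\<close> nodes, hence lies deeper.\<close>

lemma heavy_path:
  assumes "distinct (labels T)" "length (labels T) + M = n" "n div 2 < length (labels T)"
  shows "\<exists>v\<in>nodes T. heavy_gf (n div 2) z T = (\<Sum>j<tree_dist T (root T) v. z ^ j) \<and>
    (\<forall>u\<in>nodes T. loaded_dist M T v < loaded_dist M T u \<or>
      loaded_dist M T v = loaded_dist M T u \<and>
      (u = v \<or> tree_dist T (root T) v < tree_dist T (root T) u))"
  using assms
proof (induction T arbitrary: M)
  case (Vertex r ts)
  let ?T = "Vertex r ts"
  let ?s = "n div 2"
  let ?f = "\<lambda>t. of_bool (?s < length (labels t)) + z * heavy_gf ?s z t"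
  have light: "(\<Sum>t\<leftarrow>xs. ?f t) = 0" if "\<And>t. t \<in> set xs \<Longrightarrow> length (labels t) \<le> ?s" for xs
  proof -
    have "(\<Sum>t\<leftarrow>xs. ?f t) = (\<Sum>t\<leftarrow>xs. 0)"
      by (intro arg_cong[of _ _ sum_list] map_cong) (use that in \<open>auto simp: heavy_gf_light not_less[symmetric]\<close>)
    then show ?thesis by simp
  qed
  have light_branch: "loaded_dist M ?T r \<le> loaded_dist M ?T u"
    if "t \<in> set ts" "u \<in> nodes t" "length (labels t) \<le> ?s" for t u
  proof (rule loaded_dist_light_branch[OF Vertex.prems(1) that(1,2)])
    show "2 * length (labels t) \<le> M + length (labels ?T)"
      using that(3) Vertex.prems(2) by linarith
  qed
  show ?case
  proof (cases "\<exists>t\<in>set ts. ?s < length (labels t)")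
    case False
    have "loaded_dist M ?T r < loaded_dist M ?T u \<or> loaded_dist M ?T r = loaded_dist M ?T u \<and>
        (u = r \<or> tree_dist ?T r r < tree_dist ?T r u)" if u: "u \<in> nodes ?T" for u
    proof (cases "u = r")
      case u_r: False
      then obtain t where t: "t \<in> set ts" "u \<in> nodes t" using u by (auto simp: nodes_Vertex)
      have "loaded_dist M ?T r \<le> loaded_dist M ?T u"
        by (rule light_branch[OF t]) (use False t in force)
      moreover have "tree_dist ?T r r < tree_dist ?T r u"
        using tree_dist_root_child[OF Vertex.prems(1) t] by simp
      ultimately show ?thesis by auto
    qed simp
    moreover have "heavy_gf ?s z ?T = (\<Sum>j<tree_dist ?T r r. z ^ j)"
      using light[of ts] False by (auto simp: not_less)
    ultimately show ?thesis
      by (intro bexI[of _ r]) (auto simp: nodes_Vertex)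
  next
    case True
    then obtain t where t: "t \<in> set ts" and heavy: "?s < length (labels t)" by blast
    obtain xs ys where ts: "ts = xs @ t # ys" using split_list[OF t] by blast
    have others: "length (labels t') \<le> ?s" if "t' \<in> set xs \<union> set ys" for t'
    proof -
      have "length (labels t') \<le> (\<Sum>t\<leftarrow>xs @ ys. length (labels t))"
        using that by (intro member_le_sum_list) auto
      then have "length (labels t) + length (labels t') < length (labels ?T)"
        by (simp add: ts length_concat o_def)
      with heavy Vertex.prems(2) show ?thesis by linarith
    qed
    define M' where "M' = M + length (labels ?T) - length (labels t)"
    have M': "length (labels t) + M' = n"
      using length_labels_child[OF t, of r] Vertex.prems(2) unfolding M'_def by linarith
    note dist_t = distinct_Vertex(2)[OF Vertex.prems(1) t]
    from Vertex.IH[OF t dist_t M' heavy] obtain v where v: "v \<in> nodes t"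
      and gf: "heavy_gf ?s z t = (\<Sum>j<tree_dist t (root t) v. z ^ j)"
      and best: "\<And>u. u \<in> nodes t \<Longrightarrow> loaded_dist M' t v < loaded_dist M' t u \<or>
        loaded_dist M' t v = loaded_dist M' t u \<and>
        (u = v \<or> tree_dist t (root t) v < tree_dist t (root t) u)" by blast
    note child = loaded_dist_child[OF Vertex.prems(1) t _ M'_def]
    have below_root: "loaded_dist M ?T v < loaded_dist M ?T r"
      using child[OF v] best[OF root_in_nodes] heavy M' by linarith
    have "heavy_gf ?s z ?T = (\<Sum>t\<leftarrow>xs. ?f t) + (?f t + (\<Sum>t\<leftarrow>ys. ?f t))"
      by (simp add: ts)
    also have "\<dots> = 1 + z * (\<Sum>j<tree_dist t (root t) v. z ^ j)"
      using light[of xs] light[of ys] others heavy gf by simp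
    also have "\<dots> = (\<Sum>j<tree_dist ?T r v. z ^ j)"
      unfolding tree_dist_root_child[OF Vertex.prems(1) t v] Suc_eq_plus1[symmetric]
        sum.lessThan_Suc_shift by (simp add: sum_distrib_left)
    finally have "heavy_gf ?s z ?T = (\<Sum>j<tree_dist ?T r v. z ^ j)" .
    moreover have "loaded_dist M ?T v < loaded_dist M ?T u \<or>
        loaded_dist M ?T v = loaded_dist M ?T u \<and>
        (u = v \<or> tree_dist ?T r v < tree_dist ?T r u)" if u: "u \<in> nodes ?T" for u
    proof (cases "u \<in> nodes t")
      case True
      then show ?thesis
        using child[OF v] child[OF True] best[OF True]
          tree_dist_root_child[OF Vertex.prems(1) t v]
          tree_dist_root_child[OF Vertex.prems(1) t True] by linarith
    next
      case False
      have "loaded_dist M ?T r \<le> loaded_dist M ?T u"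
      proof (cases "u = r")
        case u_r: False
        then obtain t' where t': "t' \<in> set ts" "u \<in> nodes t'" using u by (auto simp: nodes_Vertex)
        with False have "t' \<noteq> t" by blast
        with t' have "t' \<in> set xs \<union> set ys" by (simp add: ts)
        from light_branch[OF t' others[OF this]] show ?thesis .
      qed simp
      with below_root show ?thesis by linarith
    qed
    moreover have "v \<in> nodes ?T" using v t by (auto simp: nodes_Vertex)
    ultimately show ?thesis by auto
  qed
qed

text \<open>The heavy nodes other than the root are those on the path to the centroid, one at each depth
  from \<open>1\<close> to that of the centroid. With two minimisers of the total distance the path ends at the
  upper one, in agreement with the choice of the centroid nearest to the root.\<close>

theorem heavy_gf_centroid_depth:
  assumes "distinct (labels T)"
  shows "heavy_gf (length (labels T) div 2) z T = (\<Sum>j<centroid_depth T. z ^ j)"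
proof -
  have "length (labels T) div 2 < length (labels T)"
    using length_labels_pos[of T] by linarith
  from heavy_path[OF assms _ this, of 0 z]
  obtain v where v: "v \<in> nodes T"
    and gf: "heavy_gf (length (labels T) div 2) z T = (\<Sum>j<tree_dist T (root T) v. z ^ j)"
    and best: "\<And>u. u \<in> nodes T \<Longrightarrow> total_dist T v < total_dist T u \<or>
      total_dist T v = total_dist T u \<and>
      (u = v \<or> tree_dist T (root T) v < tree_dist T (root T) u)"
    by (auto simp: loaded_dist_def)
  have "centroid_depth T = tree_dist T (root T) v"
    unfolding centroid_depth_def centroid_def
  proof (rule arg_min_equality)
    show "is_centroid T v" unfolding is_centroid_iff using v best by fastforce
    fix u assume "is_centroid T u"
    then have "u \<in> nodes T" "total_dist T u \<le> total_dist T v"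
      unfolding is_centroid_iff using v by auto
    with best[of u] show "tree_dist T (root T) v \<le> tree_dist T (root T) u" by force
  qed
  with gf show ?thesis by simp
qed

section \<open>Growing a tree by one leaf\<close>

text \<open>All trees obtained from \<open>T\<close> by attaching a new leaf \<open>x\<close>; a node with \<open>k\<close> children
  offers \<open>k + 1\<close> places for it. Lists rather than sets keep sums over the results recursive
  without any disjointness conditions.\<close>

fun grow :: "nat \<Rightarrow> plane_tree \<Rightarrow> plane_tree list"
  and grow_forest :: "nat \<Rightarrow> plane_tree list \<Rightarrow> plane_tree list list" where
  "grow x (Vertex v ts) = map (Vertex v) (grow_forest x ts)"
| "grow_forest x [] = [[Vertex x []]]"
| "grow_forest x (t # ts) =
     (Vertex x [] # t # ts) # map (\<lambda>t'. t' # ts) (grow x t) @ map ((#) t) (grow_forest x ts)"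

lemma grow_labels:
  "T' \<in> set (grow x T) \<Longrightarrow> mset (labels T') = add_mset x (mset (labels T))"
  "ts' \<in> set (grow_forest x ts) \<Longrightarrow>
     mset (concat (map labels ts')) = add_mset x (mset (concat (map labels ts)))"
  by (induction x T and x ts arbitrary: T' and ts' rule: grow_grow_forest.induct) fastforce+

lemma length_labels_grow: "T' \<in> set (grow x T) \<Longrightarrow> length (labels T') = Suc (length (labels T))"
  using grow_labels(1)[of T' x T, THEN arg_cong[of _ _ size]] by simp

lemma nodes_grow: "T' \<in> set (grow x T) \<Longrightarrow> nodes T' = insert x (nodes T)"
  using grow_labels(1)[of T' x T, THEN arg_cong[of _ _ set_mset]] by (simp add: nodes_def)

lemma root_grow: "T' \<in> set (grow x T) \<Longrightarrow> root T' = root T"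
  by (cases T) auto

lemma distinct_labels_grow:
  assumes "T' \<in> set (grow x T)"
  shows "distinct (labels T') \<longleftrightarrow> x \<notin> nodes T \<and> distinct (labels T)"
proof -
  have "mset (labels T') = mset (x # labels T)" using grow_labels(1)[OF assms] by simp
  from mset_eq_imp_distinct_iff[OF this] show ?thesis by (simp add: nodes_def)
qed

lemma increasing_grow:
  "T' \<in> set (grow x T) \<Longrightarrow> increasing T \<Longrightarrow> \<forall>y\<in>nodes T. y < x \<Longrightarrow> increasing T'"
  "ts' \<in> set (grow_forest x ts) \<Longrightarrow> \<forall>t\<in>set ts. v < root t \<and> increasing t \<Longrightarrow>
     \<forall>t\<in>set ts. \<forall>y\<in>nodes t. y < x \<Longrightarrow> v < x \<Longrightarrow> \<forall>t\<in>set ts'. v < root t \<and> increasing t"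
proof (induction x T and x ts arbitrary: T' and ts' v rule: grow_grow_forest.induct)
  case (1 x v ts)
  then obtain ts' where "T' = Vertex v ts'" "ts' \<in> set (grow_forest x ts)" by auto
  with "1.IH"[of ts' v] "1.prems"(2,3) show ?case by (simp add: nodes_Vertex)
next
  case (2 x)
  then show ?case by simp
next
  case (3 x t ts)
  from "3.prems"(1) consider "ts' = Vertex x [] # t # ts"
    | t' where "t' \<in> set (grow x t)" "ts' = t' # ts"
    | us where "us \<in> set (grow_forest x ts)" "ts' = t # us" by auto
  then show ?case
  proof cases
    case 1
    then show ?thesis using 3 by simp
  next
    case 2
    then show ?thesis using 3 root_grow[of t' x t] by simp
  next
    case c: 3
    then show ?thesis using "3.IH"(2)[OF c(1), of v] "3.prems" by simp
  qed
qed

lemma distinct_grow: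
  "x \<notin> nodes T \<Longrightarrow> distinct (grow x T)"
  "x \<notin> (\<Union>t\<in>set ts. nodes t) \<Longrightarrow> distinct (grow_forest x ts)"
proof (induction x T and x ts rule: grow_grow_forest.induct)
  case (1 x v ts)
  then show ?case by (simp add: nodes_Vertex distinct_map inj_on_def)
next
  case (2 x)
  then show ?case by simp
next
  case (3 x t ts)
  then have x: "x \<notin> nodes t" by simp
  have "root t \<noteq> x" using x root_in_nodes by metis
  moreover have "t \<notin> set (grow x t)" using x nodes_grow by blast
  ultimately show ?case
    using 3 root_grow[of "Vertex x []" x t] by (auto simp: distinct_map inj_on_def)
qed

text \<open>The inverse of growth; it shows that different trees never grow into the same tree.\<close>

fun prune :: "nat \<Rightarrow> plane_tree \<Rightarrow> plane_tree" where
  "prune x (Vertex v ts) = Vertex v (map (prune x) (filter (\<lambda>t. root t \<noteq> x) ts))"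

lemma prune_absent: "x \<notin> nodes T \<Longrightarrow> prune x T = T"
proof (induction T)
  case (Vertex v ts)
  have absent: "x \<notin> nodes t" if "t \<in> set ts" for t
    using Vertex.prems that by (auto simp: nodes_Vertex)
  then have "root t \<noteq> x" if "t \<in> set ts" for t
    using that root_in_nodes by metis
  then have "filter (\<lambda>t. root t \<noteq> x) ts = ts" by simp
  moreover have "map (prune x) ts = ts"
    using Vertex.IH absent by (intro map_idI) auto
  ultimately show ?case by simp
qed

lemma prune_forest_absent:
  assumes "x \<notin> (\<Union>t\<in>set ts. nodes t)"
  shows "map (prune x) (filter (\<lambda>t. root t \<noteq> x) ts) = ts"
proof -
  have "x \<notin> nodes (Vertex (Suc x) ts)" using assms by (simp add: nodes_Vertex)
  from prune_absent[OF this] show ?thesis by simp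
qed

lemma prune_grow:
  "T' \<in> set (grow x T) \<Longrightarrow> x \<notin> nodes T \<Longrightarrow> prune x T' = T"
  "ts' \<in> set (grow_forest x ts) \<Longrightarrow> x \<notin> (\<Union>t\<in>set ts. nodes t) \<Longrightarrow>
    map (prune x) (filter (\<lambda>t. root t \<noteq> x) ts') = ts"
proof (induction x T and x ts arbitrary: T' and ts' rule: grow_grow_forest.induct)
  case (1 x v ts)
  then show ?case by (auto simp: nodes_Vertex)
next
  case (2 x)
  then show ?case by simp
next
  case (3 x t ts)
  have x: "x \<notin> nodes t" "x \<notin> (\<Union>t\<in>set ts. nodes t)" using "3.prems"(2) by auto
  have rt: "root t \<noteq> x" using x root_in_nodes by metis
  from "3.prems"(1) consider "ts' = Vertex x [] # t # ts"
    | t' where "t' \<in> set (grow x t)" "ts' = t' # ts"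
    | us where "us \<in> set (grow_forest x ts)" "ts' = t # us" by auto
  then show ?case
  proof cases
    case 1
    then show ?thesis using prune_forest_absent[of x "t # ts"] "3.prems"(2) by simp
  next
    case 2
    then show ?thesis
      using "3.IH"(1)[OF 2(1) x(1)] root_grow[OF 2(1)] rt prune_forest_absent[OF x(2)] by simp
  next
    case c: 3
    then show ?thesis
      using "3.IH"(2)[OF c(1) x(2)] rt prune_absent[OF x(1)] by simp
  qed
qed

text \<open>In an increasing tree the largest label sits at a leaf, so pruning it removes a single node.\<close>

lemma grow_prune:
  assumes "increasing T" "distinct (labels T)" "x \<in> nodes T" "x \<noteq> root T" "\<forall>y\<in>nodes T. y \<le> x"
  shows "T \<in> set (grow x (prune x T)) \<and> increasing (prune x T) \<and> root (prune x T) = root T"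
  using assms
proof (induction T)
  case (Vertex v ts)
  have forest: "us \<in> set (grow_forest x (map (prune x) (filter (\<lambda>t. root t \<noteq> x) us)))
      \<and> (\<forall>t\<in>set (map (prune x) (filter (\<lambda>t. root t \<noteq> x) us)). v < root t \<and> increasing t)"
    if "set us \<subseteq> set ts" "distinct (concat (map labels us))" "x \<in> (\<Union>t\<in>set us. nodes t)" for us
    using that
  proof (induction us)
    case (Cons t us)
    let ?p = "\<lambda>us. map (prune x) (filter (\<lambda>t. root t \<noteq> x) us)"
    have t: "t \<in> set ts" using Cons.prems(1) by simp
    have inc: "increasing t" "v < root t" "\<forall>y\<in>nodes t. y \<le> x"
      using Vertex.prems(1,5) t by (auto simp: nodes_Vertex)
    have dist: "distinct (labels t)" using Cons.prems(2) by simp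
    show ?case
    proof (cases "x \<in> nodes t")
      case True
      then have absent: "x \<notin> (\<Union>t\<in>set us. nodes t)"
        using Cons.prems(2) by (auto simp: nodes_def)
      note rest = prune_forest_absent[OF absent]
      have us: "\<forall>t\<in>set us. v < root t \<and> increasing t"
        using Vertex.prems(1) Cons.prems(1) by auto
      show ?thesis
      proof (cases "root t = x")
        case True
        obtain ts' where ts': "t = Vertex x ts'" using True by (cases t) auto
        have "ts' = []"
        proof (rule ccontr)
          assume "ts' \<noteq> []"
          then obtain t' where t': "t' \<in> set ts'" by (cases ts') auto
          then have "x < root t'" "root t' \<in> nodes t"
            using inc(1) by (auto simp: ts' nodes_Vertex intro!: bexI[of _ t'])
          with inc(3) show False by auto
        qed
        with ts' rest us show ?thesis by (cases us) auto
      next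
        case False
        from Vertex.IH[OF t inc(1) dist True] False inc(3)
        have "t \<in> set (grow x (prune x t))" "increasing (prune x t)" "root (prune x t) = root t"
          by auto
        with False rest us inc(2) show ?thesis by simp
      qed
    next
      case False
      then have "x \<in> (\<Union>t\<in>set us. nodes t)" using Cons.prems(3) by simp
      with Cons have IH: "us \<in> set (grow_forest x (?p us))"
          "\<forall>t\<in>set (?p us). v < root t \<and> increasing t" by auto
      have "root t \<noteq> x" using False root_in_nodes by metis
      then have "?p (t # us) = t # ?p us" using prune_absent[OF False] by simp
      with IH inc show ?thesis by simp
    qed
  qed simp
  have "x \<in> (\<Union>t\<in>set ts. nodes t)" "distinct (concat (map labels ts))"
    using Vertex.prems by (auto simp: nodes_Vertex)
  from forest[OF order_refl this(2,1)] show ?case by simp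
qed

theorem increasing_trees_Suc:
  assumes "n \<ge> 1"
  shows "increasing_trees (Suc n) = (\<Union>T\<in>increasing_trees n. set (grow (Suc n) T))"
proof (intro equalityI subsetI)
  fix T assume "T \<in> increasing_trees (Suc n)"
  then have T: "distinct (labels T)" "nodes T = {1..Suc n}" "increasing T"
    by (auto simp: increasing_trees_def)
  have "root T \<noteq> Suc n"
  proof
    assume r: "root T = Suc n"
    obtain ts where ts: "T = Vertex (Suc n) ts" using r by (cases T) auto
    have "1 \<in> nodes T" using T(2) by auto
    then obtain t where "t \<in> set ts" using assms by (auto simp: ts nodes_Vertex)
    moreover from this have "root t \<in> nodes T" by (auto simp: ts nodes_Vertex intro!: bexI[of _ t])
    ultimately show False using T(2,3) by (auto simp: ts)
  qed
  with grow_prune[OF T(3,1), of "Suc n"] T(2)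
  have P: "T \<in> set (grow (Suc n) (prune (Suc n) T))" "increasing (prune (Suc n) T)"
    by auto
  have d: "Suc n \<notin> nodes (prune (Suc n) T)" "distinct (labels (prune (Suc n) T))"
    using distinct_labels_grow[OF P(1)] T(1) by auto
  have "nodes (prune (Suc n) T) = {1..n}"
  proof -
    have "nodes (prune (Suc n) T) = insert (Suc n) (nodes (prune (Suc n) T)) - {Suc n}"
      using d(1) by (rule Diff_insert_absorb[symmetric])
    also have "\<dots> = {1..Suc n} - {Suc n}"
      by (rule arg_cong[where f = "\<lambda>A. A - {Suc n}"]) (rule trans[OF nodes_grow[OF P(1), symmetric] T(2)])
    also have "\<dots> = {1..n}" by (auto simp: le_Suc_eq)
    finally show ?thesis .
  qed
  with P d show "T \<in> (\<Union>T\<in>increasing_trees n. set (grow (Suc n) T))"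
    by (auto simp: increasing_trees_def)
next
  fix T' assume "T' \<in> (\<Union>T\<in>increasing_trees n. set (grow (Suc n) T))"
  then obtain T where T: "distinct (labels T)" "nodes T = {1..n}" "increasing T"
    and T': "T' \<in> set (grow (Suc n) T)" by (auto simp: increasing_trees_def)
  have "increasing T'" using increasing_grow(1)[OF T' T(3)] T(2) by auto
  with T nodes_grow[OF T'] distinct_labels_grow[OF T'] show "T' \<in> increasing_trees (Suc n)"
    by (auto simp: increasing_trees_def)
qed

lemma increasing_trees_1: "increasing_trees 1 = {Vertex 1 []}"
proof (intro equalityI subsetI)
  fix T assume "T \<in> increasing_trees 1"
  then have T: "distinct (labels T)" "nodes T = {1}"
    by (auto simp: increasing_trees_def)
  then have "length (labels T) = 1" using card_nodes[OF T(1)] by simp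
  moreover obtain v ts where ts: "T = Vertex v ts" by (cases T)
  ultimately have "ts = []"
    using length_labels_child[of "hd ts" ts v] length_labels_pos[of "hd ts"] by (cases ts) auto
  with T ts show "T \<in> {Vertex 1 []}" by (simp add: nodes_def)
qed (simp add: increasing_trees_def nodes_def)

lemma finite_increasing_trees: "n \<ge> 1 \<Longrightarrow> finite (increasing_trees n)"
proof (induction n rule: nat_induct_at_least)
  case base
  then show ?case unfolding increasing_trees_1 by simp
next
  case (Suc n)
  have "finite (\<Union>T\<in>increasing_trees n. set (grow (Suc n) T))"
    using Suc.IH by (intro finite_UN_I finite_set)
  then show ?case by (simp only: increasing_trees_Suc[OF Suc.hyps])
qed

lemma length_labels_increasing:
  assumes "T \<in> increasing_trees n" shows "length (labels T) = n"
proof -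
  have T: "distinct (labels T)" "nodes T = {1..n}" using assms by (auto simp: increasing_trees_def)
  from card_nodes[OF T(1)] show ?thesis unfolding T(2) by simp
qed

lemma sum_increasing_trees_Suc:
  fixes g :: "plane_tree \<Rightarrow> real"
  assumes "n \<ge> 1"
  shows "(\<Sum>T\<in>increasing_trees (Suc n). g T) =
    (\<Sum>T\<in>increasing_trees n. \<Sum>T'\<leftarrow>grow (Suc n) T. g T')"
proof -
  have absent: "Suc n \<notin> nodes T" if "T \<in> increasing_trees n" for T
    using that by (simp add: increasing_trees_def)
  have "(\<Sum>T\<in>increasing_trees (Suc n). g T) =
      (\<Sum>T\<in>increasing_trees n. \<Sum>T'\<in>set (grow (Suc n) T). g T')"
    unfolding increasing_trees_Suc[OF assms]
  proof (rule sum.UNION_disjoint)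
    show "\<forall>T\<in>increasing_trees n. \<forall>S\<in>increasing_trees n. T \<noteq> S \<longrightarrow>
        set (grow (Suc n) T) \<inter> set (grow (Suc n) S) = {}"
      using prune_grow(1)[of _ "Suc n"] absent by (metis disjoint_iff)
  qed (use finite_increasing_trees[OF assms] in simp_all)
  also have "\<dots> = (\<Sum>T\<in>increasing_trees n. \<Sum>T'\<leftarrow>grow (Suc n) T. g T')"
    by (intro sum.cong refl sum_list_distinct_conv_sum_set[symmetric] distinct_grow absent)
  finally show ?thesis .
qed

section \<open>The degree weights\<close>

lemma degree_fps_0: "fps_nth (degree_fps c1 c2) 0 = 1"
  by (simp add: degree_fps_def)

text \<open>The ratio of consecutive weights is affine in the degree; this is what makes the random tree
  a growth process in which a node of out-degree \<open>k\<close> attracts with strength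
  \<open>\<alpha> - (\<alpha> - 1) k\<close>.\<close>

lemma degree_fps_Suc:
  assumes "c1 > 0" "\<alpha> = 1 + c2 / c1"
  shows "(real k + 1) * fps_nth (degree_fps c1 c2) (Suc k)
    = c1 * (\<alpha> - (\<alpha> - 1) * real k) * fps_nth (degree_fps c1 c2) k"
proof (cases "c2 = 0")
  case True
  have nth: "fps_nth (degree_fps c1 c2) j = c1 ^ j / fact j" for j
    using True by (simp add: degree_fps_def)
  have k: "real k + 1 = real (Suc k)" by simp
  show ?thesis
    unfolding nth fact_Suc k using True assms(2) by (simp del: of_nat_Suc)
next
  case False
  define a where "a = 1 + c1 / c2"
  have nth: "fps_nth (degree_fps c1 c2) j = c2 ^ j * (a gchoose j)" for j
    using False by (simp add: degree_fps_def a_def fps_compose_linear)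
  have "(real k + 1) * (a gchoose Suc k) = (a - real k) * (a gchoose k)"
    using gbinomial_mult_1[of a k] by (simp add: algebra_simps)
  moreover have "c2 * (a - real k) = c1 * (\<alpha> - (\<alpha> - 1) * real k)"
  proof -
    have e: "c1 * \<alpha> = c1 + c2" "c2 * a = c1 + c2"
      using False assms by (simp_all add: a_def field_simps)
    have "c1 * (\<alpha> - (\<alpha> - 1) * real k) = c1 * \<alpha> - (c1 * \<alpha> - c1) * real k"
      by (simp only: algebra_simps)
    also have "\<dots> = c2 * (a - real k)"
      unfolding right_diff_distrib e by simp
    finally show ?thesis ..
  qed
  ultimately show ?thesis unfolding nth power_Suc by (metis mult.assoc mult.left_commute)
qed

section \<open>Weighted growth\<close>

abbreviation forest_weight :: "real fps \<Rightarrow> plane_tree list \<Rightarrow> real" where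
  "forest_weight \<phi> ts \<equiv> prod_list (map (weight \<phi>) ts)"

text \<open>An additive statistic of a forest changes in one summand only, except when the new leaf
  becomes a tree of its own. The weight \<open>a\<close> of the length and the offset \<open>b\<close> vary in the
  induction.\<close>

lemma sum_grow_forest:
  fixes f g r :: "plane_tree \<Rightarrow> real"
  assumes "fps_nth \<phi> 0 = 1"
    and "\<And>t. t \<in> set ts \<Longrightarrow> (\<Sum>t'\<leftarrow>grow x t. weight \<phi> t') = weight \<phi> t * r t"
    and "\<And>t. t \<in> set ts \<Longrightarrow> (\<Sum>t'\<leftarrow>grow x t. weight \<phi> t' * f t') = weight \<phi> t * g t"
  shows "(\<Sum>ts'\<leftarrow>grow_forest x ts. a (length ts') * forest_weight \<phi> ts' * (b + sum_list (map f ts')))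
    = forest_weight \<phi> ts *
        ((real (length ts) + 1) * a (Suc (length ts)) * (b + sum_list (map f ts) + f (Vertex x []))
         + a (length ts) * (\<Sum>t\<leftarrow>ts. r t * (b + sum_list (map f ts) - f t) + g t))"
  using assms(2,3)
proof (induction ts arbitrary: a b)
  case Nil
  then show ?case using assms(1) by simp
next
  case (Cons t ts)
  let ?W = "forest_weight \<phi> ts" and ?F = "sum_list (map f ts)"
  let ?k = "length ts" and ?w = "weight \<phi>"
  have r: "(\<Sum>t'\<leftarrow>grow x t. ?w t') = ?w t * r t"
    and g: "(\<Sum>t'\<leftarrow>grow x t. ?w t' * f t') = ?w t * g t"
    using Cons.prems by simp_all
  have "(\<Sum>t'\<leftarrow>grow x t. a (Suc ?k) * (?w t' * ?W) * (b + (f t' + ?F)))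
      = (\<Sum>t'\<leftarrow>grow x t. a (Suc ?k) * ?W * (b + ?F) * ?w t' + a (Suc ?k) * ?W * (?w t' * f t'))"
    by (simp add: algebra_simps)
  also have "\<dots> = a (Suc ?k) * ?W * (b + ?F) * (?w t * r t) + a (Suc ?k) * ?W * (?w t * g t)"
    unfolding sum_list_addf sum_list_const_mult r g ..
  finally have inside: "(\<Sum>t'\<leftarrow>grow x t. a (Suc ?k) * (?w t' * ?W) * (b + (f t' + ?F))) = \<dots>" .
  have "(\<Sum>us\<leftarrow>grow_forest x ts. a (Suc (length us)) * (?w t * forest_weight \<phi> us)
        * (b + (f t + sum_list (map f us))))
      = (\<Sum>us\<leftarrow>grow_forest x ts. ?w t * (a (Suc (length us)) * forest_weight \<phi> us
        * ((b + f t) + sum_list (map f us))))"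
    by (simp add: algebra_simps)
  also have "\<dots> = ?w t * (?W * ((real ?k + 1) * a (Suc (Suc ?k)) * (b + f t + ?F + f (Vertex x []))
      + a (Suc ?k) * (\<Sum>t'\<leftarrow>ts. r t' * (b + f t + ?F - f t') + g t')))"
    unfolding sum_list_const_mult
    using Cons.IH[of "\<lambda>k. a (Suc k)" "b + f t"] Cons.prems by simp
  finally have tail: "(\<Sum>us\<leftarrow>grow_forest x ts. a (Suc (length us)) * (?w t * forest_weight \<phi> us)
        * (b + (f t + sum_list (map f us)))) = \<dots>" .
  have "(\<Sum>ts'\<leftarrow>grow_forest x (t # ts).
        a (length ts') * forest_weight \<phi> ts' * (b + sum_list (map f ts')))
      = a (Suc (Suc ?k)) * (?w t * ?W) * (b + (f (Vertex x []) + (f t + ?F)))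
        + (\<Sum>t'\<leftarrow>grow x t. a (Suc ?k) * (?w t' * ?W) * (b + (f t' + ?F)))
        + (\<Sum>us\<leftarrow>grow_forest x ts. a (Suc (length us)) * (?w t * forest_weight \<phi> us)
            * (b + (f t + sum_list (map f us))))"
    using assms(1) by (simp add: o_def)
  then show ?case
    unfolding inside tail by (simp add: algebra_simps)
qed

text \<open>The degree weights enter the analysis only through the ratio of consecutive weights.\<close>

locale degree_weights =
  fixes \<phi> :: "real fps" and c \<alpha> :: real
  assumes nth_0: "fps_nth \<phi> 0 = 1"
    and nth_Suc: "\<And>k. (real k + 1) * fps_nth \<phi> (Suc k)
      = c * (\<alpha> - (\<alpha> - 1) * real k) * fps_nth \<phi> k"
begin

abbreviation "w \<equiv> weight \<phi>"

abbreviation "size_of T \<equiv> real (length (labels T))"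

lemma size_of_Vertex: "size_of (Vertex v ts) = 1 + (\<Sum>t\<leftarrow>ts. size_of t)"
  by (induction ts) (simp_all)

text \<open>A new child of the root contributes its own value of \<open>f\<close>; a leaf attached inside a branch
  \<open>t\<close> changes \<open>f t\<close> only, which gives the last sum.\<close>

lemma sum_grow_additive:
  fixes f g r :: "plane_tree \<Rightarrow> real"
  assumes "\<And>t. t \<in> set ts \<Longrightarrow> (\<Sum>t'\<leftarrow>grow x t. w t') = w t * (c * (size_of t + \<alpha> - 1))"
    and "\<And>t. t \<in> set ts \<Longrightarrow> (\<Sum>t'\<leftarrow>grow x t. w t' * f t') = w t * g t"
  shows "(\<Sum>T'\<leftarrow>grow x (Vertex v ts). w T' * (b + sum_list (map f (subtrees T')))) =
    w (Vertex v ts) * (c * (size_of (Vertex v ts) + \<alpha> - 1) * (b + sum_list (map f ts))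
      + c * (\<alpha> - (\<alpha> - 1) * real (length ts)) * f (Vertex x [])
      + (\<Sum>t\<leftarrow>ts. g t - c * (size_of t + \<alpha> - 1) * f t))"
proof -
  let ?F = "b + sum_list (map f ts)" and ?k = "length ts"
  have "(\<Sum>T'\<leftarrow>grow x (Vertex v ts). w T' * (b + sum_list (map f (subtrees T'))))
      = (\<Sum>ts'\<leftarrow>grow_forest x ts. fps_nth \<phi> (length ts') * forest_weight \<phi> ts' * (b + sum_list (map f ts')))"
    by (simp add: o_def)
  also have "\<dots> = forest_weight \<phi> ts *
        ((real ?k + 1) * fps_nth \<phi> (Suc ?k) * (?F + f (Vertex x []))
         + fps_nth \<phi> ?k * (\<Sum>t\<leftarrow>ts. c * (size_of t + \<alpha> - 1) * (?F - f t) + g t))"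
    by (rule sum_grow_forest[OF nth_0 assms])
  also have "(\<Sum>t\<leftarrow>ts. c * (size_of t + \<alpha> - 1) * (?F - f t) + g t)
      = (\<Sum>t\<leftarrow>ts. c * ?F * size_of t + c * ?F * (\<alpha> - 1) + (g t - c * (size_of t + \<alpha> - 1) * f t))"
    by (simp add: algebra_simps)
  also have "\<dots> = c * ?F * (size_of (Vertex v ts) - 1) + real ?k * (c * ?F * (\<alpha> - 1))
      + (\<Sum>t\<leftarrow>ts. g t - c * (size_of t + \<alpha> - 1) * f t)"
    unfolding sum_list_addf sum_list_const_mult size_of_Vertex by (simp add: sum_list_triv)
  finally show ?thesis
    unfolding nth_Suc by (simp add: algebra_simps)
qed

text \<open>A tree with \<open>n\<close> nodes has \<open>n - 1\<close> edges, so the attractions \<open>\<alpha> - (\<alpha> - 1) k\<close> of its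
  nodes add up to \<open>n + \<alpha> - 1\<close>, whatever its shape.\<close>

lemma sum_weight_grow:
  "(\<Sum>T'\<leftarrow>grow x T. w T') = w T * (c * (size_of T + \<alpha> - 1))"
proof (induction T)
  case (Vertex v ts)
  have "(\<Sum>T'\<leftarrow>grow x (Vertex v ts). w T' * (1 + sum_list (map (\<lambda>_. 0) (subtrees T')))) =
    w (Vertex v ts) * (c * (size_of (Vertex v ts) + \<alpha> - 1) * (1 + sum_list (map (\<lambda>_. 0) ts))
      + c * (\<alpha> - (\<alpha> - 1) * real (length ts)) * 0
      + (\<Sum>t\<leftarrow>ts. 0 - c * (size_of t + \<alpha> - 1) * 0))"
    by (rule sum_grow_additive) (simp_all add: Vertex.IH)
  then show ?case by (simp only: sum_list_0 mult_zero_right add_0_right diff_self mult_1_right)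
qed

text \<open>A fringe subtree of size \<open>s\<close> attracts the new leaf with strength \<open>s + \<alpha> - 1\<close> and
  then becomes a subtree of size \<open>s + 1\<close>.\<close>

lemma sum_heavy_gf_grow:
  assumes "s \<ge> 1"
  shows "(\<Sum>T'\<leftarrow>grow x T. w T' * heavy_gf s z T') =
    w T * (c * ((size_of T - real s) * heavy_gf s z T + (real s + \<alpha> - 1) * heavy_gf (s - 1) z T))"
proof (induction T)
  case (Vertex v ts)
  define f where "f s t = of_bool (s < length (labels t)) + z * heavy_gf s z t" for s t
  define g where "g t = c * (of_bool (s < Suc (length (labels t))) * (size_of t + \<alpha> - 1)
    + z * ((size_of t - real s) * heavy_gf s z t + (real s + \<alpha> - 1) * heavy_gf (s - 1) z t))" for t
  have F: "heavy_gf s z T = 0 + sum_list (map (f s) (subtrees T))" for s T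
    by (cases T) (simp add: f_def[abs_def])
  have g: "(\<Sum>t'\<leftarrow>grow x t. w t' * f s t') = w t * g t" if "t \<in> set ts" for t
  proof -
    have "(\<Sum>t'\<leftarrow>grow x t. w t' * f s t') = (\<Sum>t'\<leftarrow>grow x t.
        of_bool (s < Suc (length (labels t))) * w t' + z * (w t' * heavy_gf s z t'))"
      by (intro arg_cong[of _ _ sum_list] map_cong)
        (auto simp: f_def length_labels_grow algebra_simps)
    then show ?thesis
      unfolding sum_list_addf sum_list_const_mult sum_weight_grow Vertex.IH[OF that] g_def
      by (simp add: algebra_simps)
  qed
  have diff: "g t - c * (size_of t + \<alpha> - 1) * f s t = c * (real s + \<alpha> - 1) * (f (s - 1) t - f s t)" for t
  proof (cases s "length (labels t)" rule: linorder_cases)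
    case equal
    have "s - 1 < s" using assms by simp
    with equal show ?thesis using assms by (simp add: g_def f_def algebra_simps)
  qed (use assms in \<open>auto simp: g_def f_def algebra_simps\<close>)
  have leaf: "f s (Vertex x []) = 0" using assms by (simp add: f_def)
  have "(\<Sum>T'\<leftarrow>grow x (Vertex v ts). w T' * heavy_gf s z T')
      = (\<Sum>T'\<leftarrow>grow x (Vertex v ts). w T' * (0 + sum_list (map (f s) (subtrees T'))))"
    by (simp only: F)
  also have "\<dots> = w (Vertex v ts) * (c * (size_of (Vertex v ts) + \<alpha> - 1) * (0 + sum_list (map (f s) ts))
      + c * (\<alpha> - (\<alpha> - 1) * real (length ts)) * f s (Vertex x [])
      + (\<Sum>t\<leftarrow>ts. g t - c * (size_of t + \<alpha> - 1) * f s t))"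
    by (rule sum_grow_additive[OF sum_weight_grow g])
  also have "\<dots> = w (Vertex v ts) * (c * (size_of (Vertex v ts) + \<alpha> - 1) * sum_list (map (f s) ts)
      + c * (real s + \<alpha> - 1) * (sum_list (map (f (s - 1)) ts) - sum_list (map (f s) ts)))"
    unfolding diff leaf sum_list_const_mult sum_list_subtractf by simp
  finally show ?case
    unfolding F plane_tree.sel by (simp only: add_0) (simp only: algebra_simps)
qed

text \<open>For \<open>s = 0\<close> the fringe subtrees stay counted, but each new leaf counts as well: below
  a node of depth \<open>d\<close> and out-degree \<open>k\<close> it adds \<open>z ^ d\<close> with strength
  \<open>\<alpha> - (\<alpha> - 1) k\<close>. Distributing the term in \<open>k\<close> over the children expresses the sum of these by
  the statistic itself.\<close>

lemma sum_heavy_gf_0_grow: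
  "(\<Sum>T'\<leftarrow>grow x T. w T' * heavy_gf 0 z T') =
    w T * (c * (\<alpha> + (size_of T + \<alpha> * z) * heavy_gf 0 z T))"
proof (induction T)
  case (Vertex v ts)
  define f where "f t = 1 + z * heavy_gf 0 z t" for t
  define g where "g t = c * ((size_of t + \<alpha> - 1)
    + z * (\<alpha> + (size_of t + \<alpha> * z) * heavy_gf 0 z t))" for t
  have F: "heavy_gf 0 z T = 0 + sum_list (map f (subtrees T))" for T
    by (cases T) (simp add: f_def[abs_def] length_labels_pos del: length_greater_0_conv)
  have g: "(\<Sum>t'\<leftarrow>grow x t. w t' * f t') = w t * g t" if "t \<in> set ts" for t
  proof -
    have "(\<Sum>t'\<leftarrow>grow x t. w t' * f t') = (\<Sum>t'\<leftarrow>grow x t. w t' + z * (w t' * heavy_gf 0 z t'))"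
      by (intro arg_cong[of _ _ sum_list] map_cong) (auto simp: f_def algebra_simps)
    then show ?thesis
      unfolding sum_list_addf sum_list_const_mult sum_weight_grow Vertex.IH[OF that] g_def
      by (simp add: algebra_simps)
  qed
  have diff: "g t - c * (size_of t + \<alpha> - 1) * f t = c * (\<alpha> * z - \<alpha> + 1) * f t + c * (\<alpha> - 1)" for t
    by (simp add: g_def f_def algebra_simps)
  have leaf: "f (Vertex x []) = 1" by (simp add: f_def)
  have "(\<Sum>T'\<leftarrow>grow x (Vertex v ts). w T' * heavy_gf 0 z T')
      = (\<Sum>T'\<leftarrow>grow x (Vertex v ts). w T' * (0 + sum_list (map f (subtrees T'))))"
    by (simp only: F)
  also have "\<dots> = w (Vertex v ts) * (c * (size_of (Vertex v ts) + \<alpha> - 1) * (0 + sum_list (map f ts))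
      + c * (\<alpha> - (\<alpha> - 1) * real (length ts)) * f (Vertex x [])
      + (\<Sum>t\<leftarrow>ts. g t - c * (size_of t + \<alpha> - 1) * f t))"
    by (rule sum_grow_additive[OF sum_weight_grow g])
  also have "\<dots> = w (Vertex v ts) * (c * (size_of (Vertex v ts) + \<alpha> - 1) * sum_list (map f ts)
      + c * (\<alpha> - (\<alpha> - 1) * real (length ts))
      + c * (\<alpha> * z - \<alpha> + 1) * sum_list (map f ts) + real (length ts) * (c * (\<alpha> - 1)))"
    unfolding diff leaf sum_list_const_mult sum_list_addf by (simp add: sum_list_triv)
  finally show ?case
    unfolding F plane_tree.sel by (simp only: add_0) (simp only: algebra_simps)
qed

end

section \<open>The centroid depth in a random tree\<close>

context degree_weights
begin

definition total_weight :: "nat \<Rightarrow> real" where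
  "total_weight n = (\<Sum>T\<in>increasing_trees n. w T)"

definition heavy_weight :: "nat \<Rightarrow> real \<Rightarrow> nat \<Rightarrow> real" where
  "heavy_weight s z n = (\<Sum>T\<in>increasing_trees n. w T * heavy_gf s z T)"

lemma total_weight_1: "total_weight 1 = 1"
  unfolding total_weight_def increasing_trees_1 by (simp add: nth_0)

lemma total_weight_Suc:
  assumes "n \<ge> 1"
  shows "total_weight (Suc n) = c * (real n + \<alpha> - 1) * total_weight n"
proof -
  have "total_weight (Suc n) = (\<Sum>T\<in>increasing_trees n. w T * (c * (size_of T + \<alpha> - 1)))"
    unfolding total_weight_def sum_increasing_trees_Suc[OF assms] sum_weight_grow ..
  also have "\<dots> = (\<Sum>T\<in>increasing_trees n. c * (real n + \<alpha> - 1) * w T)"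
    by (rule sum.cong) (simp_all add: length_labels_increasing)
  finally show ?thesis by (simp add: total_weight_def sum_distrib_left)
qed

lemma total_weight_pos: "n \<ge> 1 \<Longrightarrow> c > 0 \<Longrightarrow> \<alpha> > 0 \<Longrightarrow> total_weight n > 0"
proof (induction n rule: nat_induct_at_least)
  case base
  show ?case unfolding total_weight_1 by simp
next
  case (Suc n)
  then show ?case by (simp add: total_weight_Suc)
qed

lemma heavy_weight_Suc:
  assumes "n \<ge> 1" "s \<ge> 1"
  shows "heavy_weight s z (Suc n) = c * ((real n - real s) * heavy_weight s z n
    + (real s + \<alpha> - 1) * heavy_weight (s - 1) z n)"
proof -
  have "heavy_weight s z (Suc n) = (\<Sum>T\<in>increasing_trees n. w T * (c * ((size_of T - real s)
      * heavy_gf s z T + (real s + \<alpha> - 1) * heavy_gf (s - 1) z T)))"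
    unfolding heavy_weight_def sum_increasing_trees_Suc[OF assms(1)]
      sum_heavy_gf_grow[OF assms(2)] ..
  also have "\<dots> = (\<Sum>T\<in>increasing_trees n. c * (real n - real s) * (w T * heavy_gf s z T)
      + c * (real s + \<alpha> - 1) * (w T * heavy_gf (s - 1) z T))"
    by (rule sum.cong) (simp_all add: length_labels_increasing algebra_simps)
  also have "\<dots> = c * (real n - real s) * heavy_weight s z n
      + c * (real s + \<alpha> - 1) * heavy_weight (s - 1) z n"
    by (simp only: heavy_weight_def sum.distrib sum_distrib_left)
  finally show ?thesis by (simp only: algebra_simps)
qed

lemma heavy_weight_0_Suc:
  assumes "n \<ge> 1"
  shows "heavy_weight 0 z (Suc n)
    = c * (\<alpha> * total_weight n + (real n + \<alpha> * z) * heavy_weight 0 z n)"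
proof -
  have "heavy_weight 0 z (Suc n)
      = (\<Sum>T\<in>increasing_trees n. w T * (c * (\<alpha> + (size_of T + \<alpha> * z) * heavy_gf 0 z T)))"
    unfolding heavy_weight_def sum_increasing_trees_Suc[OF assms] sum_heavy_gf_0_grow ..
  also have "\<dots> = (\<Sum>T\<in>increasing_trees n. c * \<alpha> * w T
      + c * (real n + \<alpha> * z) * (w T * heavy_gf 0 z T))"
    by (rule sum.cong) (simp_all add: length_labels_increasing algebra_simps)
  also have "\<dots> = c * \<alpha> * total_weight n + c * (real n + \<alpha> * z) * heavy_weight 0 z n"
    by (simp only: heavy_weight_def total_weight_def sum.distrib sum_distrib_left)
  finally show ?thesis by (simp only: algebra_simps)
qed

text \<open>A non-constant solution of the recurrence for \<open>heavy_weight\<close>, divided by the total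
  weight, for \<open>z = 1 + t\<close>. As \<open>1 + \<alpha> t / (j + \<alpha>) = (j + \<alpha> z) / (j + \<alpha>)\<close>, the product is a
  ratio of rising factorials.\<close>

definition heavy_product :: "real \<Rightarrow> nat \<Rightarrow> nat \<Rightarrow> real" where
  "heavy_product t s n =
     (real n + \<alpha> - 1) / (real s + \<alpha>) * (\<Prod>j\<in>{s<..<n}. 1 + \<alpha> * t / (real j + \<alpha>))"

lemma heavy_product_Suc:
  assumes "\<alpha> > 0" "s < n"
  shows "(real s + \<alpha>) * heavy_product t s (Suc n)
    = (real n + \<alpha> + \<alpha> * t) * (\<Prod>j\<in>{s<..<n}. 1 + \<alpha> * t / (real j + \<alpha>))"
proof -
  have "{s<..<Suc n} = insert n {s<..<n}" using assms(2) by auto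
  then have "(real s + \<alpha>) * heavy_product t s (Suc n) = (real s + \<alpha>) * ((real n + \<alpha>) / (real s + \<alpha>)
      * ((1 + \<alpha> * t / (real n + \<alpha>)) * (\<Prod>j\<in>{s<..<n}. 1 + \<alpha> * t / (real j + \<alpha>))))"
    by (simp add: heavy_product_def)
  also have "\<dots> = ((real n + \<alpha>) * (1 + \<alpha> * t / (real n + \<alpha>)))
      * (\<Prod>j\<in>{s<..<n}. 1 + \<alpha> * t / (real j + \<alpha>))"
    using assms(1) by (simp add: add_nonneg_pos less_imp_neq[THEN not_sym])
  also have "(real n + \<alpha>) * (1 + \<alpha> * t / (real n + \<alpha>)) = real n + \<alpha> + \<alpha> * t"
  proof -
    have "real n + \<alpha> \<noteq> 0" using assms(1) by linarith
    then show ?thesis by (simp add: field_simps)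
  qed
  finally show ?thesis .
qed

lemma heavy_product_pred:
  assumes "\<alpha> > 0" "1 \<le> s" "s < n"
  shows "(real s + \<alpha> - 1) * heavy_product t (s - 1) n
    = (real s + \<alpha> + \<alpha> * t) / (real s + \<alpha>) * (real n + \<alpha> - 1)
        * (\<Prod>j\<in>{s<..<n}. 1 + \<alpha> * t / (real j + \<alpha>))"
proof -
  have "{s - 1<..<n} = insert s {s<..<n}" using assms by auto
  then have "heavy_product t (s - 1) n = (real n + \<alpha> - 1) / (real s + \<alpha> - 1)
      * ((1 + \<alpha> * t / (real s + \<alpha>)) * (\<Prod>j\<in>{s<..<n}. 1 + \<alpha> * t / (real j + \<alpha>)))"
    using assms(2) by (simp add: heavy_product_def of_nat_diff algebra_simps)
  moreover have "real s + \<alpha> - 1 \<noteq> 0" "real s + \<alpha> \<noteq> 0" using assms by linarith+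
  ultimately show ?thesis by (simp add: add_divide_distrib)
qed

lemma heavy_product_rec:
  assumes "\<alpha> > 0" "1 \<le> s" "s < n"
  shows "(real n + \<alpha> - 1) * heavy_product t s (Suc n)
    = (real n - real s) * heavy_product t s n + (real s + \<alpha> - 1) * heavy_product t (s - 1) n"
proof -
  have nz: "real s + \<alpha> \<noteq> 0" using assms by linarith
  define P where "P = (\<Prod>j\<in>{s<..<n}. 1 + \<alpha> * t / (real j + \<alpha>))"
  have A: "(real s + \<alpha>) * heavy_product t s (Suc n) = (real n + \<alpha> + \<alpha> * t) * P"
    using heavy_product_Suc[OF assms(1,3)] by (simp add: P_def)
  have B: "(real s + \<alpha>) * heavy_product t s n = (real n + \<alpha> - 1) * P"
    using nz by (simp add: heavy_product_def P_def)
  have C: "(real s + \<alpha>) * ((real s + \<alpha> - 1) * heavy_product t (s - 1) n)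
      = (real s + \<alpha> + \<alpha> * t) * (real n + \<alpha> - 1) * P"
    unfolding heavy_product_pred[OF assms] using nz by (simp add: P_def)
  have "(real s + \<alpha>) * ((real n + \<alpha> - 1) * heavy_product t s (Suc n))
      = (real n + \<alpha> - 1) * ((real s + \<alpha>) * heavy_product t s (Suc n))"
    by (simp only: mult.left_commute)
  also have "\<dots> = (real n - real s) * ((real n + \<alpha> - 1) * P)
      + (real s + \<alpha> + \<alpha> * t) * (real n + \<alpha> - 1) * P"
    unfolding A by (simp add: algebra_simps)
  also have "\<dots> = (real s + \<alpha>) * ((real n - real s) * heavy_product t s n
      + (real s + \<alpha> - 1) * heavy_product t (s - 1) n)"
    unfolding B[symmetric] C[symmetric] by (simp add: algebra_simps)
  finally show ?thesis using nz by simp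
qed

text \<open>Constants solve the recurrence in \<open>n\<close> and \<open>s\<close> too, and the combination of constant and
  product is determined by the recurrence at \<open>s = 0\<close>, whose inhomogeneous term is responsible for
  the factor \<open>1 + \<alpha> t\<close>. Both sides vanish at \<open>s = n - 1\<close>, as only the root has a fringe
  subtree of \<open>n\<close> nodes.\<close>

lemma heavy_weight_eq:
  assumes "\<alpha> > 0" "n \<ge> 1" "s < n"
  shows "(1 + \<alpha> * t) * heavy_weight s (1 + t) n = total_weight n * (\<alpha> * (heavy_product t s n - 1))"
  using assms(2,3)
proof (induction n arbitrary: s rule: nat_induct_at_least)
  case base
  then have "s = 0" by simp
  moreover have "heavy_product t 0 1 = 1" using assms(1) by (simp add: heavy_product_def)
  moreover have "heavy_weight 0 (1 + t) 1 = 0"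
    unfolding heavy_weight_def increasing_trees_1 by simp
  ultimately show ?case by simp
next
  case (Suc n)
  let ?H = "\<lambda>s. heavy_weight s (1 + t) n" and ?W = "total_weight n"
  have pos: "real n + \<alpha> - 1 \<noteq> 0" "real n + \<alpha> \<noteq> 0" using Suc.hyps assms(1) by linarith+
  consider "s = 0" | "1 \<le> s" "s < n" | "s = n" "1 \<le> s"
    using Suc.prems Suc.hyps by linarith
  then show ?case
  proof cases
    case 1
    have IH: "(1 + \<alpha> * t) * ?H 0 = ?W * (\<alpha> * (heavy_product t 0 n - 1))"
      using Suc.IH[of 0] Suc.hyps by simp
    define P where "P = (\<Prod>j\<in>{0<..<n}. 1 + \<alpha> * t / (real j + \<alpha>))"
    have A: "\<alpha> * heavy_product t 0 (Suc n) = (real n + \<alpha> + \<alpha> * t) * P"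
      using heavy_product_Suc[OF assms(1), of 0 n t] Suc.hyps by (simp add: P_def)
    have B: "\<alpha> * heavy_product t 0 n = (real n + \<alpha> - 1) * P"
      using assms(1) by (simp add: heavy_product_def P_def)
    have "(1 + \<alpha> * t) * heavy_weight 0 (1 + t) (Suc n)
        = c * ((1 + \<alpha> * t) * (\<alpha> * ?W) + (real n + \<alpha> * (1 + t)) * ((1 + \<alpha> * t) * ?H 0))"
      unfolding heavy_weight_0_Suc[OF Suc.hyps] by (simp only: algebra_simps)
    also have "\<dots> = c * ?W * ((1 + \<alpha> * t) * \<alpha>
        + (real n + \<alpha> * (1 + t)) * (\<alpha> * heavy_product t 0 n - \<alpha>))"
      unfolding IH by (simp only: algebra_simps)
    also have "\<dots> = c * ?W * (real n + \<alpha> - 1) * ((real n + \<alpha> + \<alpha> * t) * P - \<alpha>)"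
      unfolding B by (simp add: algebra_simps)
    also have "\<dots> = total_weight (Suc n) * (\<alpha> * (heavy_product t 0 (Suc n) - 1))"
      unfolding A[symmetric] total_weight_Suc[OF Suc.hyps] by (simp add: algebra_simps)
    finally show ?thesis using 1 by simp
  next
    case 2
    have IH: "(1 + \<alpha> * t) * ?H s = ?W * (\<alpha> * (heavy_product t s n - 1))"
      "(1 + \<alpha> * t) * ?H (s - 1) = ?W * (\<alpha> * (heavy_product t (s - 1) n - 1))"
      using Suc.IH[of s] Suc.IH[of "s - 1"] 2 by simp_all
    have "(1 + \<alpha> * t) * heavy_weight s (1 + t) (Suc n)
        = c * ((real n - real s) * ((1 + \<alpha> * t) * ?H s)
            + (real s + \<alpha> - 1) * ((1 + \<alpha> * t) * ?H (s - 1)))"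
      unfolding heavy_weight_Suc[OF Suc.hyps 2(1)] by (simp only: algebra_simps)
    also have "\<dots> = c * ?W * \<alpha> * ((real n - real s) * heavy_product t s n
        + (real s + \<alpha> - 1) * heavy_product t (s - 1) n - (real n + \<alpha> - 1))"
      unfolding IH by (simp add: algebra_simps)
    also have "\<dots> = total_weight (Suc n) * (\<alpha> * (heavy_product t s (Suc n) - 1))"
      unfolding heavy_product_rec[OF assms(1) 2, symmetric] total_weight_Suc[OF Suc.hyps]
      by (simp add: algebra_simps)
    finally show ?thesis .
  next
    \<comment> \<open>The induction hypothesis is not available at \<open>s = n\<close>, but there its coefficient
      \<open>n - s\<close> vanishes.\<close>
    case 3
    have "{n - 1<..<n} = {}" "{n<..<Suc n} = {}" by auto
    then have one: "heavy_product t (n - 1) n = 1" "heavy_product t n (Suc n) = 1"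
      using pos Suc.hyps by (simp_all add: heavy_product_def of_nat_diff algebra_simps)
    have "(1 + \<alpha> * t) * ?H (n - 1) = 0"
      using Suc.IH[of "n - 1"] Suc.hyps one(1) by simp
    moreover have "(1 + \<alpha> * t) * heavy_weight n (1 + t) (Suc n)
        = c * (real n + \<alpha> - 1) * ((1 + \<alpha> * t) * ?H (n - 1))"
      unfolding heavy_weight_Suc[OF Suc.hyps Suc.hyps] by (simp add: algebra_simps)
    ultimately have "(1 + \<alpha> * t) * heavy_weight n (1 + t) (Suc n) = 0"
      by (simp only: mult_zero_right)
    then show ?thesis using one 3 by simp
  qed
qed

end

lemma weight_nonneg: "(\<And>k. fps_nth \<phi> k \<ge> 0) \<Longrightarrow> weight \<phi> T \<ge> 0"
  by (induction T) (auto intro!: mult_nonneg_nonneg prod_list_nonneg)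

lemma (in degree_weights) expectation_random_tree:
  assumes "\<phi> = degree_fps c1 c2" "\<And>k. fps_nth \<phi> k \<ge> 0" "c > 0" "\<alpha> > 0" "n \<ge> 1"
  shows "measure_pmf.expectation (random_tree c1 c2 n) f
    = (\<Sum>T\<in>increasing_trees n. w T / total_weight n * f T)"
proof -
  define q where "q T = (if T \<in> increasing_trees n then w T / total_weight n else 0)" for T
  note fin = finite_increasing_trees[OF assms(5)]
  have W: "total_weight n > 0" by (rule total_weight_pos[OF assms(5,3,4)])
  have q_nonneg: "q T \<ge> 0" for T
    using weight_nonneg[OF assms(2), of T] W by (simp add: q_def)
  have "(\<integral>\<^sup>+T. ennreal (q T) \<partial>count_space UNIV) = (\<Sum>T\<in>increasing_trees n. ennreal (q T))"
    by (rule nn_integral_count_space'[OF fin]) (auto simp: q_def)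
  also have "\<dots> = ennreal (\<Sum>T\<in>increasing_trees n. q T)"
    using q_nonneg by (simp add: sum_ennreal)
  also have "(\<Sum>T\<in>increasing_trees n. q T) = 1"
    using W by (simp add: q_def sum_divide_distrib[symmetric] total_weight_def[symmetric])
  finally have q_pmf: "pmf (embed_pmf q) T = q T" for T
    using q_nonneg by (intro pmf_embed_pmf) simp_all
  have "random_tree c1 c2 n = embed_pmf q"
    unfolding random_tree_def assms(1)[symmetric] q_def[abs_def] total_weight_def ..
  then have "measure_pmf.expectation (random_tree c1 c2 n) f
      = (\<Sum>T\<in>increasing_trees n. f T * pmf (embed_pmf q) T)"
    using fin by (simp only:) (rule integral_measure_pmf_real, simp_all add: set_pmf_iff q_pmf q_def split: if_splits)
  also have "\<dots> = (\<Sum>T\<in>increasing_trees n. w T / total_weight n * f T)"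
    by (intro sum.cong refl) (simp add: q_pmf q_def)
  finally show ?thesis .
qed

text \<open>As a polynomial in \<open>t\<close> this is \<open>((1 + t) ^ d - 1) / t\<close>, so its coefficients are the
  binomial coefficients of \<open>d\<close>.\<close>

definition depth_poly :: "nat \<Rightarrow> real poly" where
  "depth_poly d = (\<Sum>j<d. [:1, 1:] ^ j)"

lemma coeff_one_plus_X_power: "coeff ([:1, 1:] ^ d :: real poly) m = real (d choose m)"
proof (cases "m \<le> d")
  case False
  have "degree ([:1, 1:] ^ d :: real poly) \<le> d" using degree_power_le[of "[:1, 1::real:]" d] by simp
  with False show ?thesis by (simp add: coeff_eq_0 binomial_eq_0)
qed (simp add: coeff_linear_poly_power)

lemma coeff_depth_poly: "coeff (depth_poly d) m = real (d choose Suc m)"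
  by (induction d) (simp_all add: depth_poly_def coeff_one_plus_X_power)

lemma poly_depth_poly: "poly (depth_poly d) t = (\<Sum>j<d. (1 + t) ^ j)"
  by (simp add: depth_poly_def poly_sum)

lemma falling_fact_real: "falling_fact (real d) m = fact m * real (d choose m)"
  by (simp add: falling_fact_def binomial_gbinomial gbinomial_prod_rev atLeast0LessThan)

context degree_weights
begin

text \<open>The mean of \<open>depth_poly\<close> over the random tree; its coefficients are the binomial moments
  of the centroid depth.\<close>

definition centroid_poly :: "nat \<Rightarrow> real poly" where
  "centroid_poly n =
     (\<Sum>T\<in>increasing_trees n. smult (w T / total_weight n) (depth_poly (centroid_depth T)))"

lemma coeff_centroid_poly:
  "coeff (centroid_poly n) m =
    (\<Sum>T\<in>increasing_trees n. w T / total_weight n * real (centroid_depth T choose Suc m))"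
  by (simp add: centroid_poly_def coeff_sum coeff_depth_poly)

text \<open>The explicit formula for \<open>heavy_weight\<close> holds for every real \<open>t\<close>, hence is an identity of
  polynomials, and coefficients may be compared.\<close>

lemma centroid_poly_eq:
  assumes "c > 0" "\<alpha> > 0" "n \<ge> 1"
  shows "[:1, \<alpha>:] * centroid_poly n = smult \<alpha>
    (smult ((real n + \<alpha> - 1) / (real (n div 2) + \<alpha>))
      (\<Prod>j\<in>{n div 2<..<n}. [:1, \<alpha> / (real j + \<alpha>):]) - 1)"
proof -
  have W: "total_weight n > 0" by (rule total_weight_pos[OF assms(3,1,2)])
  have at_t: "poly (centroid_poly n) t = heavy_weight (n div 2) (1 + t) n / total_weight n" for t
  proof -
    have "poly (centroid_poly n) t = (\<Sum>T\<in>increasing_trees n.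
        w T * heavy_gf (n div 2) (1 + t) T / total_weight n)"
      unfolding centroid_poly_def poly_sum
    proof (rule sum.cong)
      fix T assume T: "T \<in> increasing_trees n"
      then have "distinct (labels T)" by (simp add: increasing_trees_def)
      from heavy_gf_centroid_depth[OF this, of "1 + t"]
      show "poly (smult (w T / total_weight n) (depth_poly (centroid_depth T))) t
          = w T * heavy_gf (n div 2) (1 + t) T / total_weight n"
        by (simp add: poly_depth_poly length_labels_increasing[OF T])
    qed simp
    then show ?thesis by (simp only: heavy_weight_def sum_divide_distrib)
  qed
  have half: "n div 2 < n" using assms(3) by simp
  show ?thesis
  proof (rule poly_eq_poly_eq_iff[THEN iffD1], rule ext)
    fix t
    have "poly ([:1, \<alpha>:] * centroid_poly n) t = (1 + \<alpha> * t) * poly (centroid_poly n) t"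
      by (simp add: algebra_simps)
    also have "\<dots> = \<alpha> * (heavy_product t (n div 2) n - 1)"
      unfolding at_t times_divide_eq_right heavy_weight_eq[OF assms(2,3) half] using W by simp
    also have "\<dots> = poly (smult \<alpha> (smult ((real n + \<alpha> - 1) / (real (n div 2) + \<alpha>))
        (\<Prod>j\<in>{n div 2<..<n}. [:1, \<alpha> / (real j + \<alpha>):]) - 1)) t"
      by (simp add: poly_prod heavy_product_def mult.commute)
    finally show "poly ([:1, \<alpha>:] * centroid_poly n) t = \<dots>" .
  qed
qed

end

section \<open>Limits of the factorial moments\<close>

text \<open>For elementary symmetric polynomials \<open>e\<^sub>m\<close> in nonnegative variables with sum \<open>p\<close>, the
  product \<open>p e\<^sub>m\<close> is \<open>(m + 1) e\<^sub>m\<^sub>+\<^sub>1\<close> plus the terms with a repeated variable. There are \<open>m\<close>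
  choices for the repetition, and each costs a factor of at most \<open>u\<close>.\<close>

lemma coeff_prod_linear_bounds:
  fixes y :: "'a \<Rightarrow> real"
  assumes "finite A" "\<And>j. j \<in> A \<Longrightarrow> 0 \<le> y j" "\<And>j. j \<in> A \<Longrightarrow> y j \<le> u"
  defines "e \<equiv> \<lambda>A. coeff (\<Prod>j\<in>A. [:1, y j:])"
  shows "0 \<le> e A m \<and> (sum y A - real m * u) * e A m \<le> real (Suc m) * e A (Suc m)
    \<and> real (Suc m) * e A (Suc m) \<le> sum y A * e A m"
  using assms(1-3)
proof (induction A arbitrary: m rule: finite_induct)
  case empty
  show ?case
  proof (cases m)
    case 0
    then show ?thesis by (simp add: e_def)
  qed (simp add: e_def)
next
  case (insert a A)
  have ya: "0 \<le> y a" "y a \<le> u" using insert.prems by auto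
  have IH: "0 \<le> e A m" "(sum y A - real m * u) * e A m \<le> real (Suc m) * e A (Suc m)"
      "real (Suc m) * e A (Suc m) \<le> sum y A * e A m" for m
    using insert.IH[of m] insert.prems by auto
  have e0: "e (insert a A) 0 = e A 0"
    and eS: "e (insert a A) (Suc m) = e A (Suc m) + y a * e A m" for m
    using insert.hyps by (simp_all add: e_def)
  have s: "sum y (insert a A) = y a + sum y A" using insert.hyps by simp
  show ?case
  proof (cases m)
    case 0
    then show ?thesis
      using IH(1)[of 0] IH(2,3)[of 0] by (simp add: e0 eS s algebra_simps)
  next
    case (Suc k)
    have "0 \<le> y a * e A k" using ya IH(1) by simp
    moreover have "y a * ((sum y A - real k * u) * e A k) \<le> y a * (real (Suc k) * e A (Suc k))"
      by (rule mult_left_mono[OF IH(2) ya(1)])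
    moreover have "y a * (real (Suc k) * e A (Suc k)) \<le> y a * (sum y A * e A k)"
      by (rule mult_left_mono[OF IH(3) ya(1)])
    moreover have "y a * (y a * e A k) \<le> u * (y a * e A k)"
      using ya IH(1) by (intro mult_right_mono) simp_all
    moreover have "0 \<le> y a * (y a * e A k)" using ya IH(1) by simp
    ultimately show ?thesis
      using IH(1)[of "Suc k"] IH(2,3)[of "Suc k"] unfolding Suc eS s
      by (simp add: algebra_simps)
  qed
qed

text \<open>If the variables become uniformly small while their sum tends to \<open>x\<close>, the terms with a
  repeated variable are negligible and the product tends to \<open>exp (x t)\<close> coefficientwise.\<close>

lemma coeff_prod_linear_tendsto:
  fixes y :: "'a \<Rightarrow> real" and A :: "nat \<Rightarrow> 'a set"
  assumes "\<And>n. finite (A n)" "\<And>n j. j \<in> A n \<Longrightarrow> 0 \<le> y j" "\<And>n j. j \<in> A n \<Longrightarrow> y j \<le> u n"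
    and p: "(\<lambda>n. sum y (A n)) \<longlonglongrightarrow> x" and u: "u \<longlonglongrightarrow> 0"
  shows "(\<lambda>n. coeff (\<Prod>j\<in>A n. [:1, y j:]) m) \<longlonglongrightarrow> x ^ m / fact m"
proof (induction m)
  case 0
  have "coeff (\<Prod>j\<in>A n. [:1, y j:]) 0 = 1" for n
    using poly_0_coeff_0[of "\<Prod>j\<in>A n. [:1, y j:]"] by (simp add: poly_prod)
  then show ?case by simp
next
  case (Suc m)
  define e where "e n = coeff (\<Prod>j\<in>A n. [:1, y j:])" for n
  have bounds: "(sum y (A n) - real m * u n) * e n m \<le> real (Suc m) * e n (Suc m)"
    "real (Suc m) * e n (Suc m) \<le> sum y (A n) * e n m" for n
    using coeff_prod_linear_bounds[of "A n" y "u n" m] assms(1-3) by (auto simp: e_def)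
  have e: "(\<lambda>n. e n m) \<longlonglongrightarrow> x ^ m / fact m" using Suc by (simp add: e_def)
  have "(\<lambda>n. (sum y (A n) - real m * u n) * e n m) \<longlonglongrightarrow> (x - real m * 0) * (x ^ m / fact m)"
    by (intro tendsto_intros p u e)
  then have lower: "(\<lambda>n. (sum y (A n) - real m * u n) * e n m) \<longlonglongrightarrow> x * (x ^ m / fact m)"
    by (simp only: mult_zero_right diff_zero)
  have upper: "(\<lambda>n. sum y (A n) * e n m) \<longlonglongrightarrow> x * (x ^ m / fact m)"
    by (intro tendsto_intros p e)
  have "(\<lambda>n. real (Suc m) * e n (Suc m)) \<longlonglongrightarrow> x * (x ^ m / fact m)"
    by (rule tendsto_sandwich[OF always_eventually[OF allI[OF bounds(1)]]
          always_eventually[OF allI[OF bounds(2)]] lower upper])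
  then have "(\<lambda>n. real (Suc m) * e n (Suc m) / real (Suc m)) \<longlonglongrightarrow> x * (x ^ m / fact m) / real (Suc m)"
    by (intro tendsto_divide tendsto_const) simp_all
  moreover have "x * (x ^ m / fact m) / real (Suc m) = x ^ Suc m / fact (Suc m)"
    by (simp add: mult.commute)
  ultimately show ?case by (simp add: e_def del: of_nat_Suc fact_Suc power_Suc)
qed

lemma half_bounds: "(real n - 1) / 2 \<le> real (n div 2)" "real (n div 2) \<le> real n / 2"
proof -
  have "n = 2 * (n div 2) + n mod 2" "n mod 2 \<le> 1" by auto
  then have "real n = 2 * real (n div 2) + real (n mod 2)" "real (n mod 2) \<le> 1" "0 \<le> real (n mod 2)"
    by (metis of_nat_add of_nat_mult of_nat_numeral, simp_all)
  then show "(real n - 1) / 2 \<le> real (n div 2)" "real (n div 2) \<le> real n / 2" by simp_all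
qed

lemma half_ratio_tendsto:
  assumes "\<alpha> > (0::real)"
  shows "(\<lambda>n. (real n + \<alpha> - 1) / (real (n div 2) + \<alpha>)) \<longlonglongrightarrow> 2"
proof (rule tendsto_sandwich)
  show "(\<lambda>n. (real n + \<alpha> - 1) / (real n / 2 + \<alpha>)) \<longlonglongrightarrow> 2" by real_asymp
  show "(\<lambda>n. (real n + \<alpha> - 1) / ((real n - 1) / 2 + \<alpha>)) \<longlonglongrightarrow> 2" by real_asymp
  show "\<forall>\<^sub>F n in sequentially. (real n + \<alpha> - 1) / (real n / 2 + \<alpha>)
      \<le> (real n + \<alpha> - 1) / (real (n div 2) + \<alpha>)"
    using eventually_ge_at_top[of 1]
    by eventually_elim (use assms half_bounds in \<open>auto intro!: divide_left_mono mult_pos_pos add_nonneg_pos\<close>)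
  show "\<forall>\<^sub>F n in sequentially. (real n + \<alpha> - 1) / (real (n div 2) + \<alpha>)
      \<le> (real n + \<alpha> - 1) / ((real n - 1) / 2 + \<alpha>)"
    using eventually_ge_at_top[of 1]
    by eventually_elim (use assms half_bounds in \<open>auto intro!: divide_left_mono mult_pos_pos add_nonneg_pos\<close>)
qed

text \<open>Each summand lies between two increments of the logarithm, so the sum is
  \<open>ln n - ln (n / 2)\<close> up to a vanishing error.\<close>

lemma half_harmonic_tendsto:
  assumes "\<alpha> > (0::real)"
  shows "(\<lambda>n. \<Sum>j\<in>{n div 2<..<n}. 1 / (real j + \<alpha>)) \<longlonglongrightarrow> ln 2"
proof (rule tendsto_sandwich)
  have ln_half: "- ln (1 / 2) = ln (2 :: real)" by (simp add: ln_div)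
  have "(\<lambda>n. ln (real n + \<alpha>) - ln (real n / 2 + 1 + \<alpha>)) \<longlonglongrightarrow> - ln (1 / 2)" by real_asymp
  then show "(\<lambda>n. ln (real n + \<alpha>) - ln (real n / 2 + 1 + \<alpha>)) \<longlonglongrightarrow> ln 2"
    by (simp only: ln_half)
  have "(\<lambda>n. ln (real n - 1 + \<alpha>) - ln ((real n - 1) / 2 + \<alpha>)) \<longlonglongrightarrow> - ln (1 / 2)" by real_asymp
  then show "(\<lambda>n. ln (real n - 1 + \<alpha>) - ln ((real n - 1) / 2 + \<alpha>)) \<longlonglongrightarrow> ln 2"
    by (simp only: ln_half)
  have set: "{n div 2<..<n} = {Suc (n div 2)..<n}" for n by auto
  show "\<forall>\<^sub>F n in sequentially. ln (real n + \<alpha>) - ln (real n / 2 + 1 + \<alpha>)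
      \<le> (\<Sum>j\<in>{n div 2<..<n}. 1 / (real j + \<alpha>))"
    using eventually_ge_at_top[of 1]
  proof eventually_elim
    case (elim n)
    have "ln (real n + \<alpha>) - ln (real n / 2 + 1 + \<alpha>) \<le> ln (real n + \<alpha>) - ln (real (Suc (n div 2)) + \<alpha>)"
      using assms half_bounds(2)[of n] by simp
    also have "\<dots> = (\<Sum>j=Suc (n div 2)..<n. ln (real (Suc j) + \<alpha>) - ln (real j + \<alpha>))"
      using elim by (subst sum_Suc_diff') auto
    also have "\<dots> \<le> (\<Sum>j=Suc (n div 2)..<n. 1 / (real j + \<alpha>))"
    proof (rule sum_mono)
      fix j
      have pos: "real j + \<alpha> > 0" using assms by (simp add: add_nonneg_pos)
      have "ln (real (Suc j) + \<alpha>) - ln (real j + \<alpha>) = ln ((real (Suc j) + \<alpha>) / (real j + \<alpha>))"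
        using pos by (subst ln_div) auto
      also have "(real (Suc j) + \<alpha>) / (real j + \<alpha>) = 1 + 1 / (real j + \<alpha>)"
        using pos by (simp add: field_simps)
      also have "ln \<dots> \<le> 1 / (real j + \<alpha>)" using pos by (intro ln_add_one_self_le_self) simp
      finally show "ln (real (Suc j) + \<alpha>) - ln (real j + \<alpha>) \<le> 1 / (real j + \<alpha>)" .
    qed
    finally show ?case by (simp only: set)
  qed
  show "\<forall>\<^sub>F n in sequentially. (\<Sum>j\<in>{n div 2<..<n}. 1 / (real j + \<alpha>))
      \<le> ln (real n - 1 + \<alpha>) - ln ((real n - 1) / 2 + \<alpha>)"
    using eventually_ge_at_top[of 1]
  proof eventually_elim
    case (elim n)
    have "(\<Sum>j=Suc (n div 2)..<n. 1 / (real j + \<alpha>))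
        \<le> (\<Sum>j=Suc (n div 2)..<n. ln (real (Suc j) - 1 + \<alpha>) - ln (real j - 1 + \<alpha>))"
    proof (rule sum_mono)
      fix j assume "j \<in> {Suc (n div 2)..<n}"
      then have pos: "real j - 1 + \<alpha> > 0" "real j + \<alpha> > 0" using assms by auto
      have "ln (real j - 1 + \<alpha>) - ln (real j + \<alpha>) = ln ((real j - 1 + \<alpha>) / (real j + \<alpha>))"
        using pos by (subst ln_div) auto
      also have "\<dots> \<le> (real j - 1 + \<alpha>) / (real j + \<alpha>) - 1"
        using pos by (intro ln_le_minus_one divide_pos_pos)
      also have "\<dots> = - (1 / (real j + \<alpha>))" using pos by (simp add: field_simps)
      finally show "1 / (real j + \<alpha>) \<le> ln (real (Suc j) - 1 + \<alpha>) - ln (real j - 1 + \<alpha>)" by simp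
    qed
    also have "\<dots> = ln (real n - 1 + \<alpha>) - ln (real (Suc (n div 2)) - 1 + \<alpha>)"
      using elim by (subst sum_Suc_diff') auto
    also have "\<dots> \<le> ln (real n - 1 + \<alpha>) - ln ((real n - 1) / 2 + \<alpha>)"
    proof -
      have "0 < (real n - 1) / 2 + \<alpha>" using elim assms by (intro add_nonneg_pos) auto
      moreover have "(real n - 1) / 2 + \<alpha> \<le> real (Suc (n div 2)) - 1 + \<alpha>"
        using half_bounds(1)[of n] by simp
      ultimately show ?thesis by (intro diff_left_mono ln_mono) auto
    qed
    finally show ?case by (simp only: set)
  qed
qed

text \<open>For \<open>m \<ge> 1\<close> this is \<open>m!\<close> times the coefficient of \<open>t ^ (m - 1)\<close> in
  \<open>\<alpha> (2 exp (\<alpha> t ln 2) - 1) / (1 + \<alpha> t)\<close>, the limit of the mean of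
  \<open>((1 + t) ^ D - 1) / t\<close>; the recursion clears the denominator.\<close>

primrec limit_moment :: "real \<Rightarrow> nat \<Rightarrow> real" where
  "limit_moment \<alpha> 0 = 1"
| "limit_moment \<alpha> (Suc m) = \<alpha> * real (Suc m) * (2 * (\<alpha> * ln 2) ^ m - limit_moment \<alpha> m)"

context degree_weights
begin

text \<open>The factor \<open>1 + \<alpha> t\<close> in \<open>centroid_poly_eq\<close> links consecutive coefficients, so their
  limits follow by induction.\<close>

lemma centroid_poly_tendsto:
  assumes "c > 0" "\<alpha> > 0"
  shows "(\<lambda>n. fact (Suc m) * coeff (centroid_poly n) m) \<longlonglongrightarrow> limit_moment \<alpha> (Suc m)"
proof -
  define K where "K n = (real n + \<alpha> - 1) / (real (n div 2) + \<alpha>)" for n :: nat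
  define e where "e n = coeff (\<Prod>j\<in>{n div 2<..<n}. [:1, \<alpha> / (real j + \<alpha>):])" for n :: nat
  have K: "K \<longlonglongrightarrow> 2" using half_ratio_tendsto[OF assms(2)] by (simp add: K_def[abs_def])
  have e: "(\<lambda>n. e n m) \<longlonglongrightarrow> (\<alpha> * ln 2) ^ m / fact m" for m
    unfolding e_def
  proof (rule coeff_prod_linear_tendsto)
    show "(\<lambda>n. \<Sum>j\<in>{n div 2<..<n}. \<alpha> / (real j + \<alpha>)) \<longlonglongrightarrow> \<alpha> * ln 2"
      using tendsto_mult_left[OF half_harmonic_tendsto[OF assms(2)], of \<alpha>]
      by (simp add: sum_distrib_left)
    show "(\<lambda>n. \<alpha> / (real n / 2)) \<longlonglongrightarrow> 0" by real_asymp
    fix n j :: nat assume j: "j \<in> {n div 2<..<n}"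
    then have n: "real n / 2 \<le> real j" "n > 0" using half_bounds(1)[of n] by auto
    show "\<alpha> / (real j + \<alpha>) \<le> \<alpha> / (real n / 2)"
      using n assms(2) by (intro divide_left_mono mult_pos_pos) (auto intro: add_nonneg_pos)
  qed (use assms(2) in auto)
  have first: "coeff (centroid_poly n) 0 = \<alpha> * (K n * e n 0 - 1)"
    and step: "coeff (centroid_poly n) (Suc m)
      = \<alpha> * (K n * e n (Suc m)) - \<alpha> * coeff (centroid_poly n) m" if "n \<ge> 1" for n m
    using centroid_poly_eq[OF assms that, THEN arg_cong, of "\<lambda>p. coeff p 0"]
      centroid_poly_eq[OF assms that, THEN arg_cong, of "\<lambda>p. coeff p (Suc m)"]
    unfolding e_def[symmetric, abs_def] K_def[symmetric] by (simp_all add: e_def)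
  show ?thesis
  proof (induction m)
    case 0
    have "(\<lambda>n. \<alpha> * (K n * e n 0 - 1)) \<longlonglongrightarrow> \<alpha> * (2 * ((\<alpha> * ln 2) ^ 0 / fact 0) - 1)"
      by (intro tendsto_intros K e)
    moreover have "\<forall>\<^sub>F n in sequentially. \<alpha> * (K n * e n 0 - 1) = fact (Suc 0) * coeff (centroid_poly n) 0"
      using eventually_ge_at_top[of 1] by eventually_elim (simp add: first)
    ultimately have "(\<lambda>n. fact (Suc 0) * coeff (centroid_poly n) 0) \<longlonglongrightarrow> \<alpha> * (2 * ((\<alpha> * ln 2) ^ 0 / fact 0) - 1)"
      by (rule Lim_transform_eventually)
    then show ?case by simp
  next
    case (Suc m)
    have "(\<lambda>n. fact (Suc (Suc m)) * (\<alpha> * (K n * e n (Suc m)))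
        - real (Suc (Suc m)) * \<alpha> * (fact (Suc m) * coeff (centroid_poly n) m))
      \<longlonglongrightarrow> fact (Suc (Suc m)) * (\<alpha> * (2 * ((\<alpha> * ln 2) ^ Suc m / fact (Suc m))))
        - real (Suc (Suc m)) * \<alpha> * limit_moment \<alpha> (Suc m)"
      by (intro tendsto_intros K e Suc)
    moreover have "\<forall>\<^sub>F n in sequentially. fact (Suc (Suc m)) * (\<alpha> * (K n * e n (Suc m)))
        - real (Suc (Suc m)) * \<alpha> * (fact (Suc m) * coeff (centroid_poly n) m)
      = fact (Suc (Suc m)) * coeff (centroid_poly n) (Suc m)"
      using eventually_ge_at_top[of 1]
    proof eventually_elim
      case (elim n)
      show ?case
        unfolding step[OF elim] fact_Suc[of "Suc m"]
        by (simp only: algebra_simps)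
    qed
    ultimately have "(\<lambda>n. fact (Suc (Suc m)) * coeff (centroid_poly n) (Suc m))
      \<longlonglongrightarrow> fact (Suc (Suc m)) * (\<alpha> * (2 * ((\<alpha> * ln 2) ^ Suc m / fact (Suc m))))
        - real (Suc (Suc m)) * \<alpha> * limit_moment \<alpha> (Suc m)"
      by (rule Lim_transform_eventually)
    also have "fact (Suc (Suc m)) * (\<alpha> * (2 * ((\<alpha> * ln 2) ^ Suc m / fact (Suc m))))
        - real (Suc (Suc m)) * \<alpha> * limit_moment \<alpha> (Suc m) = limit_moment \<alpha> (Suc (Suc m))"
      unfolding fact_Suc[of "Suc m"] limit_moment.simps(2)[of \<alpha> "Suc m"]
      by (simp add: right_diff_distrib del: fact_Suc limit_moment.simps power_Suc)
    finally show ?case .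
  qed
qed

theorem factorial_moment_tendsto:
  assumes "\<phi> = degree_fps c1 c2" "\<And>k. fps_nth \<phi> k \<ge> 0" "c > 0" "\<alpha> > 0" "m \<ge> 1"
  shows "(\<lambda>n. measure_pmf.expectation (random_tree c1 c2 n)
    (\<lambda>T. falling_fact (real (centroid_depth T)) m)) \<longlonglongrightarrow> limit_moment \<alpha> m"
proof -
  obtain k where k: "m = Suc k" using assms(5) by (cases m) auto
  have "\<forall>\<^sub>F n in sequentially. fact m * coeff (centroid_poly n) k
    = measure_pmf.expectation (random_tree c1 c2 n) (\<lambda>T. falling_fact (real (centroid_depth T)) m)"
    using eventually_ge_at_top[of 1]
  proof eventually_elim
    case (elim n)
    show ?case
      unfolding expectation_random_tree[OF assms(1-4) elim] coeff_centroid_poly falling_fact_real k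
      unfolding sum_distrib_left by (simp only: mult.left_commute)
  qed
  from Lim_transform_eventually[OF centroid_poly_tendsto[OF assms(3,4)] this[unfolded k]]
  show ?thesis unfolding k .
qed

end

section \<open>The limit law\<close>

text \<open>Twice the Poisson distribution with mean \<open>\<alpha> ln 2\<close>, because
  \<open>2 powr (1 - \<alpha>) = 2 exp (- \<alpha> ln 2)\<close>.\<close>

definition scaled_poisson :: "real \<Rightarrow> nat \<Rightarrow> real" where
  "scaled_poisson \<alpha> h = 2 powr (1 - \<alpha>) * ((\<alpha> * ln 2) ^ h / fact h)"

lemma limit_prob_0: "(1 - \<alpha>) * limit_prob \<alpha> 0 = 1 - \<alpha> * scaled_poisson \<alpha> 0"
  by (cases "\<alpha> = 1") (simp_all add: limit_prob_def scaled_poisson_def field_simps)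

text \<open>With \<open>limit_prob_0\<close> this says \<open>(1 - \<alpha> + \<alpha> z) P(z) = 1 - \<alpha> (1 - z) B(z)\<close> for the
  generating functions \<open>P\<close> of the limit law and \<open>B\<close> of the scaled Poisson distribution. In
  contrast to the definition of the limit law it is uniform in \<open>\<alpha>\<close>.\<close>

lemma limit_prob_Suc:
  "(1 - \<alpha>) * limit_prob \<alpha> (Suc h) + \<alpha> * limit_prob \<alpha> h
    = \<alpha> * (scaled_poisson \<alpha> h - scaled_poisson \<alpha> (Suc h))"
proof (cases "\<alpha> = 1")
  case True
  then show ?thesis by (simp add: limit_prob_def scaled_poisson_def)
next
  case False
  define C where "C = 2 powr (1 - \<alpha>)"
  define S where "S = (\<Sum>j<h. ((\<alpha> - 1) * ln 2) ^ j / fact j)"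
  define u :: real where "u = ln 2 ^ h / fact h"
  define u' :: real where "u' = ln 2 ^ Suc h / fact (Suc h)"
  define r where "r = \<alpha> ^ h / (\<alpha> - 1) ^ Suc h"
  have nz: "\<alpha> - 1 \<noteq> 0" using False by simp
  have p: "limit_prob \<alpha> h = r * (C * (S + \<alpha> * ((\<alpha> - 1) ^ h * u)) - 1)"
    using False by (simp add: limit_prob_def C_def S_def u_def r_def power_mult_distrib)
  have p': "(1 - \<alpha>) * limit_prob \<alpha> (Suc h)
      = - (\<alpha> * r) * (C * (S + (\<alpha> - 1) ^ h * u + \<alpha> * ((\<alpha> - 1) ^ Suc h * u')) - 1)"
  proof -
    have "limit_prob \<alpha> (Suc h) = \<alpha> ^ Suc h / (\<alpha> - 1) ^ Suc (Suc h)
        * (C * (S + (\<alpha> - 1) ^ h * u + \<alpha> * ((\<alpha> - 1) ^ Suc h * u')) - 1)"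
      using False
      by (simp add: limit_prob_def C_def S_def u_def u'_def power_mult_distrib del: fact_Suc power_Suc)
    moreover have "(1 - \<alpha>) * (\<alpha> ^ Suc h / (\<alpha> - 1) ^ Suc (Suc h)) = - (\<alpha> * r)"
    proof -
      have "- d * (A * B / (d * q)) = - (A * (B / q))" if "d \<noteq> 0" for d A B q :: real
        using that by simp
      from this[OF nz, of \<alpha> "\<alpha> ^ h" "(\<alpha> - 1) ^ Suc h"] show ?thesis
        unfolding r_def power_Suc[of \<alpha> h] power_Suc[of "\<alpha> - 1" "Suc h"]
        by (simp only: minus_diff_eq)
    qed
    ultimately show ?thesis by (simp only: mult.assoc[symmetric])
  qed
  have r: "r * (\<alpha> - 1) ^ Suc h = \<alpha> ^ h" unfolding r_def using nz by simp
  have "(1 - \<alpha>) * limit_prob \<alpha> (Suc h) + \<alpha> * limit_prob \<alpha> h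
      = \<alpha> * C * (r * (\<alpha> - 1) ^ Suc h) * (u - \<alpha> * u')"
    unfolding p p' by (simp add: algebra_simps)
  also have "\<dots> = \<alpha> * (scaled_poisson \<alpha> h - scaled_poisson \<alpha> (Suc h))"
    unfolding r scaled_poisson_def C_def u_def u'_def power_mult_distrib
    by (simp add: algebra_simps del: fact_Suc)
  finally show ?thesis .
qed

text \<open>The terms of the remainder are dominated by \<open>a \<bar>x\<bar> ^ h / h!\<close> times
  \<open>ln 2 ^ (i + 1) / (i + 1)!\<close>, and \<open>\<Sum>\<^sub>i ln 2 ^ (i + 1) / (i + 1)! = exp (ln 2) - 1 = 1\<close>. It is
  this exact value that makes the limit law nonnegative; equality is attained for
  \<open>\<alpha> = 2\<close>, where a centroid at the root has limiting probability \<open>0\<close>.\<close>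

lemma exp_remainder_bound:
  fixes x a :: real
  assumes "\<bar>x\<bar> \<le> a * ln 2" "0 \<le> a" "a \<le> 1"
  shows "\<bar>exp x - (\<Sum>j<Suc h. x ^ j / fact j)\<bar> \<le> a * \<bar>x\<bar> ^ h / fact h"
proof -
  have x_le: "\<bar>x\<bar> \<le> ln 2"
  proof -
    have "a * ln 2 \<le> 1 * ln 2" using assms(3) by (rule mult_right_mono) simp
    with assms(1) show ?thesis by linarith
  qed
  have exp_sums: "(\<lambda>i. y ^ (i + Suc k) / fact (i + Suc k)) sums (exp y - (\<Sum>j<Suc k. y ^ j / fact j))"
    for y :: real and k
    using sums_split_initial_segment[OF exp_converges[of y], of "Suc k"]
    by (simp add: divide_inverse mult.commute del: fact_Suc power_Suc sum.lessThan_Suc)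
  define g where "g i = a * \<bar>x\<bar> ^ h / fact h * (ln 2 ^ (i + 1) / fact (i + 1))" for i
  have "(\<lambda>i. ln 2 ^ (i + 1) / fact (i + 1)) sums (1::real)"
    using exp_sums[of "ln 2" 0] by simp
  from sums_mult[OF this, of "a * \<bar>x\<bar> ^ h / fact h"]
  have g: "g sums (a * \<bar>x\<bar> ^ h / fact h)" by (simp only: g_def[abs_def] mult_1_right)
  have le: "norm (x ^ (i + Suc h) / fact (i + Suc h)) \<le> g i" for i
  proof -
    have "fact (i + 1) * fact h \<le> (fact (i + 1 + h) :: nat)"
      by (rule dvd_imp_le[OF fact_fact_dvd_fact]) simp
    then have f: "fact (i + 1) * fact h \<le> (fact (i + Suc h) :: real)"
      by (metis Suc_eq_plus1 add_Suc_shift of_nat_fact of_nat_le_iff of_nat_mult)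
    have "\<bar>x\<bar> ^ (i + Suc h) = \<bar>x\<bar> ^ h * \<bar>x\<bar> * \<bar>x\<bar> ^ i"
      by (simp add: power_add)
    also have "\<dots> \<le> \<bar>x\<bar> ^ h * (a * ln 2) * ln 2 ^ i"
      using assms x_le by (intro mult_mono power_mono mult_nonneg_nonneg) auto
    finally have "\<bar>x\<bar> ^ (i + Suc h) \<le> a * \<bar>x\<bar> ^ h * ln 2 ^ (i + 1)"
      by (simp add: mult_ac)
    with f have "\<bar>x\<bar> ^ (i + Suc h) / fact (i + Suc h)
        \<le> a * \<bar>x\<bar> ^ h * ln 2 ^ (i + 1) / (fact (i + 1) * fact h)"
      using assms(2) by (intro frac_le) (auto simp del: fact_Suc)
    then show ?thesis by (simp add: g_def abs_mult power_abs mult_ac del: fact_Suc power_Suc)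
  qed
  have "\<bar>\<Sum>i. x ^ (i + Suc h) / fact (i + Suc h)\<bar> \<le> suminf g"
    using norm_suminf_le[OF le sums_summable[OF g]] by simp
  then show ?thesis
    by (simp only: sums_unique[OF exp_sums, symmetric] sums_unique[OF g, symmetric])
qed

text \<open>The limit law differs from the scaled Poisson distribution by a correction \<open>d\<close> that never
  exceeds it. For \<open>\<alpha> \<noteq> 1\<close> the bracket in the definition of the limit law consists of one Poisson
  term and a remainder of the exponential series at \<open>(\<alpha> - 1) ln 2\<close>, which gives \<open>d\<close>; the
  remainder is controlled since \<open>\<bar>\<alpha> - 1\<bar> \<le> 1\<close>.\<close>

lemma limit_prob_bounds:
  assumes "0 < \<alpha>" "\<alpha> \<le> 2"
  shows "0 \<le> limit_prob \<alpha> h" "limit_prob \<alpha> h \<le> 2 * scaled_poisson \<alpha> h"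
proof -
  define b where "b = scaled_poisson \<alpha> h"
  have b: "0 \<le> b" using assms by (simp add: b_def scaled_poisson_def)
  have "\<exists>d. limit_prob \<alpha> h = b - d \<and> \<bar>d\<bar> \<le> b"
  proof (cases "\<alpha> = 1")
    case True
    have "ln 2 ^ h * ln 2 \<le> ln 2 ^ h * (1 + real h)"
      by (rule mult_left_mono) (use ln_le_minus_one[of "2::real"] in auto)
    then have "ln 2 ^ Suc h / fact (Suc h) \<le> ln 2 ^ h / (fact h :: real)"
      by (simp add: divide_simps mult_ac)
    then show ?thesis
      using True by (intro exI[of _ "ln 2 ^ Suc h / fact (Suc h)"])
        (simp add: limit_prob_def b_def scaled_poisson_def del: fact_Suc)
  next
    case False
    define x where "x = (\<alpha> - 1) * ln 2"
    define C where "C = 2 powr (1 - \<alpha>)"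
    define R where "R = exp x - (\<Sum>j<Suc h. x ^ j / fact j)"
    define d where "d = C * \<alpha> ^ h * R / (\<alpha> - 1) ^ Suc h"
    have nz: "\<alpha> - 1 \<noteq> 0" using False by simp
    have "C > 0" by (simp add: C_def)
    have "C * exp x = 1"
      by (simp add: C_def x_def powr_def exp_add[symmetric] algebra_simps)
    then have "limit_prob \<alpha> h = \<alpha> ^ h / (\<alpha> - 1) ^ Suc h
        * (C * ((\<Sum>j<h. x ^ j / fact j) + \<alpha> * x ^ h / fact h) - C * exp x)"
      using False by (simp add: limit_prob_def C_def x_def)
    also have "\<dots> = \<alpha> ^ h / (\<alpha> - 1) ^ Suc h * (C * ((\<alpha> - 1) * x ^ h / fact h - R))"
      by (simp add: R_def algebra_simps diff_divide_distrib)
    also have "(\<alpha> - 1) * x ^ h / fact h = (\<alpha> - 1) ^ Suc h * (ln 2 ^ h / fact h)"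
      by (simp add: x_def power_mult_distrib)
    also have "\<alpha> ^ h / (\<alpha> - 1) ^ Suc h * (C * ((\<alpha> - 1) ^ Suc h * (ln 2 ^ h / fact h) - R)) = b - d"
    proof -
      have "A / q * (C * (q * u - R)) = C * (A * u) - C * A * R / q" if "q \<noteq> 0" for A q u :: real
        using that by (simp add: field_simps)
      note expand = this
      have "b = C * (\<alpha> ^ h * (ln 2 ^ h / fact h))"
        by (simp add: b_def scaled_poisson_def C_def power_mult_distrib)
      then show ?thesis
        unfolding d_def by (simp only: expand[OF power_not_zero[OF nz]])
    qed
    finally have "limit_prob \<alpha> h = b - d" .
    moreover have "\<bar>d\<bar> \<le> b"
    proof -
      have "\<bar>R\<bar> \<le> \<bar>\<alpha> - 1\<bar> * \<bar>x\<bar> ^ h / fact h"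
        unfolding R_def by (rule exp_remainder_bound) (use assms in \<open>auto simp: x_def abs_mult\<close>)
      also have "\<dots> = \<bar>\<alpha> - 1\<bar> ^ Suc h * (ln 2 ^ h / fact h)"
        by (simp add: x_def abs_mult power_mult_distrib)
      finally have R: "\<bar>R\<bar> / \<bar>\<alpha> - 1\<bar> ^ Suc h \<le> ln 2 ^ h / fact h"
        using nz by (simp add: pos_divide_le_eq mult.commute)
      have "\<bar>d\<bar> = C * \<alpha> ^ h * (\<bar>R\<bar> / \<bar>\<alpha> - 1\<bar> ^ Suc h)"
        using \<open>C > 0\<close> assms(1) by (simp add: d_def abs_mult power_abs)
      also have "\<dots> \<le> C * \<alpha> ^ h * (ln 2 ^ h / fact h)"
        using R \<open>C > 0\<close> assms(1) by (intro mult_left_mono) auto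
      also have "\<dots> = b" by (simp add: b_def scaled_poisson_def C_def power_mult_distrib)
      finally show ?thesis .
    qed
    ultimately show ?thesis by blast
  qed
  then show "0 \<le> limit_prob \<alpha> h" "limit_prob \<alpha> h \<le> 2 * scaled_poisson \<alpha> h"
    unfolding b_def[symmetric] by auto
qed

lemma falling_fact_nonneg: "0 \<le> falling_fact (real h) m"
  by (simp add: falling_fact_real)

lemma falling_fact_0_Suc: "falling_fact 0 (Suc m) = 0"
  using falling_fact_real[of 0 "Suc m"] by simp

lemma falling_fact_Suc_Suc:
  "falling_fact (real (Suc h)) (Suc m)
    = falling_fact (real h) (Suc m) + real (Suc m) * falling_fact (real h) m"
  unfolding falling_fact_real fact_Suc binomial_Suc_Suc by (simp add: algebra_simps)

lemma scaled_poisson_sums: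
  "(\<lambda>h. falling_fact (real h) m * scaled_poisson \<alpha> h) sums (2 * (\<alpha> * ln 2) ^ m)"
proof -
  define y where "y = \<alpha> * ln 2"
  have shift: "falling_fact (real (h + m)) m * scaled_poisson \<alpha> (h + m)
      = 2 powr (1 - \<alpha>) * y ^ m * (y ^ h /\<^sub>R fact h)" for h
  proof -
    have "falling_fact (real (h + m)) m / fact (h + m) = 1 / fact h"
      unfolding falling_fact_real by (simp add: binomial_fact)
    moreover have "falling_fact (real (h + m)) m * scaled_poisson \<alpha> (h + m)
        = 2 powr (1 - \<alpha>) * y ^ (h + m) * (falling_fact (real (h + m)) m / fact (h + m))"
      by (simp add: scaled_poisson_def y_def)
    ultimately show ?thesis
      by (simp add: power_add divide_inverse mult_ac)
  qed
  have "(\<lambda>h. 2 powr (1 - \<alpha>) * y ^ m * (y ^ h /\<^sub>R fact h)) sums (2 powr (1 - \<alpha>) * y ^ m * exp y)"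
    by (intro sums_mult exp_converges)
  moreover have "2 powr (1 - \<alpha>) * exp y = 2"
    by (simp add: y_def powr_def exp_add[symmetric] algebra_simps)
  then have "2 powr (1 - \<alpha>) * y ^ m * exp y = 2 * y ^ m"
    by (simp add: mult_ac)
  ultimately have "(\<lambda>h. falling_fact (real (h + m)) m * scaled_poisson \<alpha> (h + m)) sums (2 * y ^ m)"
    by (simp only: shift)
  moreover have "falling_fact (real h) m * scaled_poisson \<alpha> h = 0" if "h < m" for h
    using that by (simp add: falling_fact_real binomial_eq_0)
  ultimately show ?thesis
    using sums_zero_iff_shift[of m "\<lambda>h. falling_fact (real h) m * scaled_poisson \<alpha> h"]
    unfolding y_def[symmetric] by blast
qed

text \<open>Multiply the recurrence \<open>limit_prob_Suc\<close> by the \<open>(m + 1)\<close>st falling factorial of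
  \<open>h + 1\<close> and sum over \<open>h\<close>. By Pascal's rule only the moments of orders \<open>m + 1\<close> and \<open>m\<close>
  appear, in the combination that defines \<open>limit_moment\<close>. For the total mass, the moment of
  order \<open>0\<close>, the sum includes the initial value \<open>limit_prob_0\<close> and shows that the probabilities
  add up to \<open>1\<close>.\<close>

theorem limit_prob_sums:
  assumes "0 < \<alpha>" "\<alpha> \<le> 2"
  shows "(\<lambda>h. falling_fact (real h) m * limit_prob \<alpha> h) sums limit_moment \<alpha> m"
proof -
  let ?F = "\<lambda>m h. falling_fact (real h) m" and ?p = "limit_prob \<alpha>" and ?b = "scaled_poisson \<alpha>"
  define M where "M m = (\<Sum>h. ?F m h * ?p h)" for m
  define B where "B m = 2 * (\<alpha> * ln 2) ^ m" for m
  have b: "(\<lambda>h. ?F m h * ?b h) sums B m" for m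
    unfolding B_def by (rule scaled_poisson_sums)
  have "summable (\<lambda>h. ?F m h * ?p h)" for m
  proof (rule summable_comparison_test')
    show "summable (\<lambda>h. 2 * (?F m h * ?b h))"
      using b by (intro summable_mult) (rule sums_summable)
    show "norm (?F m h * ?p h) \<le> 2 * (?F m h * ?b h)" for h
      using mult_left_mono[OF limit_prob_bounds(2)[OF assms] falling_fact_nonneg[of h m], of h]
        limit_prob_bounds(1)[OF assms, of h] falling_fact_nonneg[of h m]
      by (simp add: abs_mult mult_ac)
  qed
  then have p: "(\<lambda>h. ?F m h * ?p h) sums M m" for m
    unfolding M_def by (rule summable_sums)
  have up: "(\<lambda>h. ?F (Suc m) (Suc h) * f h) sums (s' + real (Suc m) * s)"
    if "(\<lambda>h. ?F m h * f h) sums s" "(\<lambda>h. ?F (Suc m) h * f h) sums s'" for m s s' f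
    using sums_add[OF that(2) sums_mult[OF that(1), of "real (Suc m)"]]
    unfolding falling_fact_Suc_Suc by (simp add: algebra_simps)
  have shift: "(\<lambda>h. ?F (Suc m) (Suc h) * f (Suc h)) sums s" if "(\<lambda>h. ?F (Suc m) h * f h) sums s" for m s f
    using that by (subst sums_Suc_iff) (simp add: falling_fact_0_Suc)
  have "M m = limit_moment \<alpha> m"
  proof (induction m)
    case 0
    have one: "?F 0 h = 1" for h by (simp add: falling_fact_def)
    have p0: "?p sums M 0" and b0: "?b sums B 0" using p[of 0] b[of 0] by (simp_all add: one)
    have p1: "(\<lambda>h. ?p (Suc h)) sums (M 0 - ?p 0)" and b1: "(\<lambda>h. ?b (Suc h)) sums (B 0 - ?b 0)"
      using p0 b0 by (simp_all add: sums_Suc_iff)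
    have "(\<lambda>h. (1 - \<alpha>) * ?p (Suc h) + \<alpha> * ?p h) sums ((1 - \<alpha>) * (M 0 - ?p 0) + \<alpha> * M 0)"
      by (intro sums_add sums_mult p0 p1)
    moreover have "(\<lambda>h. \<alpha> * (?b h - ?b (Suc h))) sums (\<alpha> * (B 0 - (B 0 - ?b 0)))"
      by (intro sums_mult sums_diff b0 b1)
    ultimately have "(1 - \<alpha>) * (M 0 - ?p 0) + \<alpha> * M 0 = \<alpha> * (B 0 - (B 0 - ?b 0))"
      unfolding limit_prob_Suc by (rule sums_unique2)
    then show ?case using limit_prob_0[of \<alpha>] by (simp add: algebra_simps)
  next
    case (Suc m)
    note sums = sums_add[OF sums_mult[OF shift[OF p[of "Suc m"]], of "1 - \<alpha>"]
        sums_mult[OF up[OF p p], of \<alpha> m]]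
    have "(\<lambda>h. (1 - \<alpha>) * (?F (Suc m) (Suc h) * ?p (Suc h)) + \<alpha> * (?F (Suc m) (Suc h) * ?p h))
        = (\<lambda>h. \<alpha> * (?F (Suc m) (Suc h) * ?b h - ?F (Suc m) (Suc h) * ?b (Suc h)))"
    proof
      fix h
      have "(1 - \<alpha>) * (?F (Suc m) (Suc h) * ?p (Suc h)) + \<alpha> * (?F (Suc m) (Suc h) * ?p h)
          = ?F (Suc m) (Suc h) * ((1 - \<alpha>) * ?p (Suc h) + \<alpha> * ?p h)"
        by (simp only: distrib_left mult.left_commute)
      also have "\<dots> = \<alpha> * (?F (Suc m) (Suc h) * ?b h - ?F (Suc m) (Suc h) * ?b (Suc h))"
        unfolding limit_prob_Suc by (simp only: right_diff_distrib mult.left_commute)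
      finally show "(1 - \<alpha>) * (?F (Suc m) (Suc h) * ?p (Suc h)) + \<alpha> * (?F (Suc m) (Suc h) * ?p h) = \<dots>" .
    qed
    with sums have "(\<lambda>h. \<alpha> * (?F (Suc m) (Suc h) * ?b h - ?F (Suc m) (Suc h) * ?b (Suc h)))
        sums ((1 - \<alpha>) * M (Suc m) + \<alpha> * (M (Suc m) + real (Suc m) * M m))"
      by (simp only:)
    moreover have "(\<lambda>h. \<alpha> * (?F (Suc m) (Suc h) * ?b h - ?F (Suc m) (Suc h) * ?b (Suc h)))
        sums (\<alpha> * ((B (Suc m) + real (Suc m) * B m) - B (Suc m)))"
      by (intro sums_mult sums_diff up shift b)
    ultimately have "(1 - \<alpha>) * M (Suc m) + \<alpha> * (M (Suc m) + real (Suc m) * M m)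
        = \<alpha> * ((B (Suc m) + real (Suc m) * B m) - B (Suc m))"
      by (rule sums_unique2)
    then show ?case using Suc by (simp add: B_def algebra_simps)
  qed
  with p[of m] show ?thesis by simp
qed

lemma limit_depth_moment:
  assumes "0 < \<alpha>" "\<alpha> \<le> 2"
  shows "integrable (measure_pmf (limit_depth \<alpha>)) (\<lambda>h. falling_fact (real h) m)"
    and "measure_pmf.expectation (limit_depth \<alpha>) (\<lambda>h. falling_fact (real h) m) = limit_moment \<alpha> m"
proof -
  note nonneg = limit_prob_bounds(1)[OF assms]
  have "limit_prob \<alpha> sums 1"
    using limit_prob_sums[OF assms, of 0] by (simp add: falling_fact_def)
  then have "(\<Sum>h. ennreal (limit_prob \<alpha> h)) = 1"
    using nonneg by (subst suminf_ennreal2) (auto simp: sums_iff)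
  then have "(\<integral>\<^sup>+h. ennreal (limit_prob \<alpha> h) \<partial>count_space UNIV) = 1"
    by (simp add: nn_integral_count_space_nat)
  with nonneg have pmf: "pmf (limit_depth \<alpha>) h = limit_prob \<alpha> h" for h
    unfolding limit_depth_def by (intro pmf_embed_pmf)
  have density: "measure_pmf (limit_depth \<alpha>) = density (count_space UNIV) (\<lambda>h. ennreal (limit_prob \<alpha> h))"
    by (simp add: measure_pmf_eq_density pmf)
  note sums = limit_prob_sums[OF assms, of m]
  have int: "integrable (count_space UNIV) (\<lambda>h. limit_prob \<alpha> h * falling_fact (real h) m)"
    unfolding integrable_count_space_nat_iff using sums nonneg
    by (simp add: sums_iff mult.commute abs_mult falling_fact_nonneg)
  then show "integrable (measure_pmf (limit_depth \<alpha>)) (\<lambda>h. falling_fact (real h) m)"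
    unfolding density by (subst integrable_density) (auto simp: nonneg)
  have "measure_pmf.expectation (limit_depth \<alpha>) (\<lambda>h. falling_fact (real h) m)
      = (\<integral>h. limit_prob \<alpha> h * falling_fact (real h) m \<partial>count_space UNIV)"
    unfolding density by (subst integral_density) (auto simp: nonneg)
  also have "\<dots> = limit_moment \<alpha> m"
    using integral_count_space_nat[OF int] sums by (simp add: sums_iff mult.commute)
  finally show "measure_pmf.expectation (limit_depth \<alpha>) (\<lambda>h. falling_fact (real h) m) = limit_moment \<alpha> m" .
qed

text \<open>Up to the factor \<open>(m + 1) \<alpha> ^ (m + 1)\<close> the right-hand side is
  \<open>J\<^sub>m = \<integral> u ^ m exp u du\<close> over the interval from \<open>0\<close> to \<open>ln 2\<close>, and the recursion is
  \<open>J\<^sub>m\<^sub>+\<^sub>1 = 2 ln 2 ^ (m + 1) - (m + 1) J\<^sub>m\<close>, that is, integration by parts.\<close>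

lemma limit_moment_Suc_eq:
  "limit_moment \<alpha> (Suc m) = real (Suc m) * \<alpha> ^ Suc m *
     (2 * (\<Sum>j<m. real (m choose j) * (- 1) ^ j * fact j * ln 2 ^ (m - j)) + (- 1) ^ m * fact m)"
proof (induction m)
  case 0
  then show ?case by simp
next
  case (Suc m)
  define S where "S m = (\<Sum>j<m. real (m choose j) * (- 1) ^ j * fact j * ln 2 ^ (m - j))" for m
  have shift: "S (Suc m) = ln 2 ^ Suc m - real (Suc m) * S m"
  proof -
    have choose: "real (Suc m choose Suc j) * fact (Suc j) = real (Suc m) * (real (m choose j) * fact j)" for j
    proof -
      have "real (Suc j) * real (Suc m choose Suc j) = real (Suc m) * real (m choose j)"
        by (metis Suc_times_binomial of_nat_mult)
      then show ?thesis unfolding fact_Suc by (simp add: mult_ac del: binomial_Suc_Suc)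
    qed
    have "S (Suc m) = ln 2 ^ Suc m + (\<Sum>j<m. real (Suc m choose Suc j) * (- 1) ^ Suc j * fact (Suc j) * ln 2 ^ (m - j))"
      unfolding S_def sum.lessThan_Suc_shift by (simp del: fact_Suc binomial_Suc_Suc power_Suc)
    also have "(\<Sum>j<m. real (Suc m choose Suc j) * (- 1) ^ Suc j * fact (Suc j) * ln 2 ^ (m - j))
        = (\<Sum>j<m. - (real (Suc m) * (real (m choose j) * (- 1) ^ j * fact j * ln 2 ^ (m - j))))"
    proof (rule sum.cong)
      fix j
      have "real (Suc m choose Suc j) * (- 1) ^ Suc j * fact (Suc j) * ln 2 ^ (m - j)
          = (real (Suc m choose Suc j) * fact (Suc j)) * ((- 1) ^ Suc j * ln 2 ^ (m - j))"
        by (simp only: mult_ac)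
      then show "real (Suc m choose Suc j) * (- 1) ^ Suc j * fact (Suc j) * ln 2 ^ (m - j)
          = - (real (Suc m) * (real (m choose j) * (- 1) ^ j * fact j * ln 2 ^ (m - j)))"
        unfolding choose by simp
    qed simp
    finally show ?thesis by (simp add: S_def sum_negf sum_distrib_left)
  qed
  have "limit_moment \<alpha> (Suc (Suc m)) = \<alpha> * real (Suc (Suc m)) * (2 * (\<alpha> * ln 2) ^ Suc m
      - real (Suc m) * \<alpha> ^ Suc m * (2 * S m + (- 1) ^ m * fact m))"
    unfolding limit_moment.simps(2)[of _ "Suc m"] Suc S_def[symmetric] ..
  also have "\<dots> = real (Suc (Suc m)) * \<alpha> ^ Suc (Suc m) * (2 * S (Suc m) + (- 1) ^ Suc m * fact (Suc m))"
    unfolding shift power_mult_distrib fact_Suc power_Suc[of _ "Suc m"] power_Suc[of "-1" m]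
    by (simp only: algebra_simps)
  finally show ?case unfolding S_def .
qed

section \<open>Mean and variance\<close>

text \<open>For \<open>d\<close>-ary trees the attraction \<open>\<alpha> - (\<alpha> - 1) k\<close> is negative for \<open>k > d\<close>, but it is
  zero for \<open>k = d\<close>, so higher degrees have weight zero.\<close>

lemma degree_fps_nonneg:
  assumes "c1 > 0" "\<alpha> = 1 + c2 / c1"
    and "\<alpha> \<le> 1 \<and> \<alpha> > 0 \<or> (\<exists>d::nat. d \<ge> 2 \<and> \<alpha> = real d / (real d - 1))"
  shows "fps_nth (degree_fps c1 c2) k \<ge> 0"
proof -
  let ?\<phi> = "fps_nth (degree_fps c1 c2)"
  have step: "?\<phi> (Suc k) = c1 * (\<alpha> - (\<alpha> - 1) * real k) * ?\<phi> k / (real k + 1)" for k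
    using degree_fps_Suc[OF assms(1,2), of k] by (simp add: field_simps)
  from assms(3) show ?thesis
  proof (elim disjE exE conjE)
    assume \<alpha>: "\<alpha> \<le> 1" "\<alpha> > 0"
    show ?thesis
    proof (induction k)
      case (Suc k)
      have "(\<alpha> - 1) * real k \<le> 0" using \<alpha> by (simp add: mult_nonpos_nonneg)
      with \<alpha> have "0 \<le> \<alpha> - (\<alpha> - 1) * real k" by linarith
      with Suc assms(1) show ?case
        unfolding step by (intro divide_nonneg_nonneg mult_nonneg_nonneg) auto
    qed (simp add: degree_fps_0)
  next
    fix d :: nat assume d: "d \<ge> 2" "\<alpha> = real d / (real d - 1)"
    have factor: "\<alpha> - (\<alpha> - 1) * real k = (real d - real k) / (real d - 1)" for k
    proof -
      have "\<alpha> - 1 = 1 / (real d - 1)" using d by (simp add: field_simps)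
      then show ?thesis unfolding d(2) by (simp add: diff_divide_distrib)
    qed
    have "?\<phi> k \<ge> 0 \<and> (k > d \<longrightarrow> ?\<phi> k = 0)"
    proof (induction k)
      case (Suc k)
      consider "k < d" | "k = d" | "k > d" by linarith
      then show ?case
      proof cases
        case 1
        then have "0 \<le> (real d - real k) / (real d - 1)" using d by simp
        with Suc assms(1) 1 show ?thesis
          unfolding step factor by (auto intro!: divide_nonneg_nonneg mult_nonneg_nonneg)
      qed (use Suc in \<open>simp_all add: step factor\<close>)
    qed (simp add: degree_fps_0)
    then show ?thesis ..
  qed
qed

lemma falling_fact_1: "falling_fact x (Suc 0) = x"
  by (simp add: falling_fact_def)

lemma falling_fact_2: "falling_fact x (Suc (Suc 0)) = x * (x - 1)"
  by (simp add: falling_fact_def)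

theorem theorem9:
  fixes c1 c2 \<alpha> :: real
  assumes "c1 > 0"
    and "\<alpha> = 1 + c2 / c1"
    and "c2 = 0 \<and> \<alpha> = 1 \<or>
         c2 < 0 \<and> 0 < \<alpha> \<and> \<alpha> < 1 \<or>
         c2 > 0 \<and> (\<exists>d::nat. d \<ge> 2 \<and> \<alpha> = real d / (real d - 1))"
  shows "(\<forall>m\<ge>1.
            (\<lambda>n. measure_pmf.expectation (random_tree c1 c2 n)
                   (\<lambda>T. falling_fact (real (centroid_depth T)) m))
              \<longlonglongrightarrow> measure_pmf.expectation (limit_depth \<alpha>) (\<lambda>h. falling_fact (real h) m) \<and>
            integrable (measure_pmf (limit_depth \<alpha>)) (\<lambda>h. falling_fact (real h) m) \<and>
            measure_pmf.expectation (limit_depth \<alpha>) (\<lambda>h. falling_fact (real h) m) =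
              real m * \<alpha> ^ m *
                (2 * (\<Sum>j<m - 1. real ((m - 1) choose j) * (- 1) ^ j * fact j * ln 2 ^ (m - 1 - j))
                 + (- 1) ^ (m - 1) * fact (m - 1))) \<and>
         (\<lambda>n. measure_pmf.expectation (random_tree c1 c2 n) (\<lambda>T. real (centroid_depth T)))
           \<longlonglongrightarrow> measure_pmf.expectation (limit_depth \<alpha>) real \<and>
         measure_pmf.expectation (limit_depth \<alpha>) real = \<alpha> \<and>
         (\<lambda>n. measure_pmf.variance (random_tree c1 c2 n) (\<lambda>T. real (centroid_depth T)))
           \<longlonglongrightarrow> measure_pmf.variance (limit_depth \<alpha>) real \<and>
         measure_pmf.variance (limit_depth \<alpha>) real = \<alpha>\<^sup>2 * (4 * ln 2 - 3) + \<alpha>"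
proof -
  define \<phi> where "\<phi> = degree_fps c1 c2"
  have admissible: "\<alpha> \<le> 1 \<and> \<alpha> > 0 \<or> (\<exists>d::nat. d \<ge> 2 \<and> \<alpha> = real d / (real d - 1))"
    using assms(3) by force
  then have \<alpha>: "0 < \<alpha>" "\<alpha> \<le> 2"
    by (auto simp: field_simps)
  have nonneg: "fps_nth \<phi> k \<ge> 0" for k
    unfolding \<phi>_def by (rule degree_fps_nonneg[OF assms(1,2) admissible])
  interpret degree_weights \<phi> c1 \<alpha>
    by unfold_locales (simp_all only: \<phi>_def degree_fps_0 degree_fps_Suc[OF assms(1,2)])
  let ?E = "\<lambda>n. measure_pmf.expectation (random_tree c1 c2 n)"
  let ?D = "\<lambda>T. real (centroid_depth T)"
  let ?EL = "measure_pmf.expectation (limit_depth \<alpha>)"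
  note moment = factorial_moment_tendsto[OF \<phi>_def nonneg assms(1) \<alpha>(1)]
  note EL = limit_depth_moment(2)[OF \<alpha>] and int = limit_depth_moment(1)[OF \<alpha>]
  have M1: "limit_moment \<alpha> (Suc 0) = \<alpha>"
    and M2: "limit_moment \<alpha> (Suc (Suc 0)) = \<alpha> * (4 * \<alpha> * ln 2 - 2 * \<alpha>)"
    by (simp_all add: algebra_simps)
  have int1: "integrable (measure_pmf (limit_depth \<alpha>)) real"
    using int[of "Suc 0"] by (simp only: falling_fact_1)
  have square: "(x::real)\<^sup>2 = falling_fact x (Suc (Suc 0)) + falling_fact x (Suc 0)" for x
    by (simp add: falling_fact_1 falling_fact_2 power2_eq_square algebra_simps)
  have mean: "?EL real = \<alpha>"
    using EL[of "Suc 0"] by (simp only: falling_fact_1 M1)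
  have variance: "measure_pmf.variance (limit_depth \<alpha>) real
      = limit_moment \<alpha> (Suc (Suc 0)) + \<alpha> - \<alpha>\<^sup>2"
  proof -
    have "integrable (measure_pmf (limit_depth \<alpha>)) (\<lambda>h. (real h)\<^sup>2)"
      unfolding square by (intro Bochner_Integration.integrable_add int)
    then have "measure_pmf.variance (limit_depth \<alpha>) real = ?EL (\<lambda>h. (real h)\<^sup>2) - (?EL real)\<^sup>2"
      by (rule measure_pmf.variance_eq[OF int1])
    also have "?EL (\<lambda>h. (real h)\<^sup>2) = limit_moment \<alpha> (Suc (Suc 0)) + limit_moment \<alpha> (Suc 0)"
      unfolding square by (subst Bochner_Integration.integral_add) (simp_all only: int EL)
    finally show ?thesis by (simp only: mean M1)
  qed
  have means: "(\<lambda>n. ?E n ?D) \<longlonglongrightarrow> \<alpha>"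
    using moment[of "Suc 0"] by (simp only: falling_fact_1 M1)
  have "(\<lambda>n. ?E n (\<lambda>T. falling_fact (?D T) (Suc (Suc 0))) + ?E n ?D - (?E n ?D)\<^sup>2)
      \<longlonglongrightarrow> limit_moment \<alpha> (Suc (Suc 0)) + \<alpha> - \<alpha>\<^sup>2"
    by (intro tendsto_intros moment means) simp
  moreover have "\<forall>\<^sub>F n in sequentially.
      ?E n (\<lambda>T. falling_fact (?D T) (Suc (Suc 0))) + ?E n ?D - (?E n ?D)\<^sup>2
      = measure_pmf.variance (random_tree c1 c2 n) ?D"
    using eventually_ge_at_top[of 1]
  proof eventually_elim
    case (elim n)
    define p where "p T = weight \<phi> T / total_weight n" for T
    define \<mu> where "\<mu> = ?E n ?D"
    have E: "?E n f = (\<Sum>T\<in>increasing_trees n. p T * f T)" for f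
      unfolding p_def by (rule expectation_random_tree[OF \<phi>_def nonneg assms(1) \<alpha>(1) elim])
    have p1: "(\<Sum>T\<in>increasing_trees n. p T) = 1"
      using E[of "\<lambda>_. 1"] by simp
    have \<mu>: "(\<Sum>T\<in>increasing_trees n. p T * ?D T) = \<mu>" unfolding \<mu>_def E ..
    have "(\<Sum>T\<in>increasing_trees n. p T * (?D T - \<mu>)\<^sup>2)
        = (\<Sum>T\<in>increasing_trees n. p T * falling_fact (?D T) (Suc (Suc 0))
            + (1 - 2 * \<mu>) * (p T * ?D T) + \<mu>\<^sup>2 * p T)"
      by (rule sum.cong) (simp_all add: falling_fact_2 power2_eq_square algebra_simps)
    also have "\<dots> = (\<Sum>T\<in>increasing_trees n. p T * falling_fact (?D T) (Suc (Suc 0)))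
        + (1 - 2 * \<mu>) * \<mu> + \<mu>\<^sup>2"
      unfolding sum.distrib sum_distrib_left[symmetric] p1 \<mu> by simp
    finally show ?case
      unfolding \<mu>_def[symmetric] unfolding E by (simp add: power2_eq_square algebra_simps)
  qed
  ultimately have variances: "(\<lambda>n. measure_pmf.variance (random_tree c1 c2 n) ?D)
      \<longlonglongrightarrow> limit_moment \<alpha> (Suc (Suc 0)) + \<alpha> - \<alpha>\<^sup>2"
    by (rule Lim_transform_eventually)
  have closed: "limit_moment \<alpha> (Suc (Suc 0)) + \<alpha> - \<alpha>\<^sup>2 = \<alpha>\<^sup>2 * (4 * ln 2 - 3) + \<alpha>"
    unfolding M2 by (simp add: power2_eq_square algebra_simps)
  show ?thesis
  proof (intro conjI allI impI)
    fix m :: nat assume m: "1 \<le> m"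
    show "(\<lambda>n. ?E n (\<lambda>T. falling_fact (?D T) m)) \<longlonglongrightarrow> ?EL (\<lambda>h. falling_fact (real h) m)"
      unfolding EL by (rule moment[OF m])
    show "integrable (measure_pmf (limit_depth \<alpha>)) (\<lambda>h. falling_fact (real h) m)"
      by (rule int)
    obtain k where k: "m = Suc k" using m by (cases m) auto
    show "?EL (\<lambda>h. falling_fact (real h) m) = real m * \<alpha> ^ m *
        (2 * (\<Sum>j<m - 1. real ((m - 1) choose j) * (- 1) ^ j * fact j * ln 2 ^ (m - 1 - j))
         + (- 1) ^ (m - 1) * fact (m - 1))"
      unfolding EL k limit_moment_Suc_eq diff_Suc_1 ..
  next
    show "(\<lambda>n. ?E n ?D) \<longlonglongrightarrow> ?EL real" unfolding mean by (rule means)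
    show "?EL real = \<alpha>" by (rule mean)
    show "(\<lambda>n. measure_pmf.variance (random_tree c1 c2 n) ?D)
        \<longlonglongrightarrow> measure_pmf.variance (limit_depth \<alpha>) real"
      unfolding variance by (rule variances)
    show "measure_pmf.variance (limit_depth \<alpha>) real = \<alpha>\<^sup>2 * (4 * ln 2 - 3) + \<alpha>"
      unfolding variance closed ..
  qed
qed

end
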